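(* Let $\mathcal{G}$, the weights, and $\epsilon>0$ be as in the context, and let $M$ be the associated $2n\times 2n$ matrix. The deterministic algorithm achieves average consensus if and only if $1$ is a simple eigenvalue of $M$ and all other eigenvalues of $M$ have modulus strictly smaller than one.
   Context: Setting: $\mathcal{G}=(\mathcal{V},\mathcal{E})$ is a digraph with $\mathcal{V}=\{1,\dots,n\}$, $n>1$, and no selfloops. An edge $(j,i)$ means that $j$ sends to $i$. Write $\mathcal{N}_i^+=\{j:(j,i)\in\mathcal{E}\}$ and $\mathcal{N}_i^-=\{h:(i,h)\in\mathcal{E}\}$. Weights: $a_{ij}\in(0,1)$ if $j\in\mathcal{N}_i^+$, $a_{ij}=0$ otherwise, and $\sum_j a_{ij}<1$. Also $b_{ih}\in(0,1)$ if $h\in\mathcal{N}_i^-$, $b_{ih}=0$ otherwise, and $\sum_h b_{ih}<1$. Matrices: $L=D-A$, where $A=[a_{ij}]$ and $D=\mathrm{diag}(\sum_j a_{ij})$. $S=(I-\tilde D)+B$, where $B=[b_{ih}]^T$ and $\tilde D=\mathrm{diag}(\sum_h b_{ih})$. The parameter is $\epsilon>0$ and $M=\begin{bmatrix} I-L & \epsilon I\\ L & S-\epsilon I\end{bmatrix}$. Deterministic algorithm: $(x(k+1),s(k+1))^T=M(x(k),s(k))^T$ with $x(k),s(k)\in\mathbb{R}^n$ and $s(0)=0$. Average consensus: the algorithm achieves it if for every $x(0)$ we have $(x(k),s(k))\to(x_a\mathbf{1},0)$ as $k\to\infty$, where $x_a=\mathbf{1}^Tx(0)/n$. *)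

theory Defs
  imports "HOL-Analysis.Analysis" "Jordan_Normal_Form.Char_Poly"
begin

text \<open>Vertices are 0,...,n-1. An edge (j,i) in E means j sends to i.
  Weights a i j and b i h are real-valued functions on vertex pairs.\<close>

definition weights_ok :: "nat \<Rightarrow> (nat \<times> nat) set \<Rightarrow> (nat \<Rightarrow> nat \<Rightarrow> real) \<Rightarrow> (nat \<Rightarrow> nat \<Rightarrow> real) \<Rightarrow> bool" where
  "weights_ok n E a b \<longleftrightarrow>
     (\<forall>i<n. \<forall>j<n. ((j,i) \<in> E \<longrightarrow> 0 < a i j \<and> a i j < 1) \<and> ((j,i) \<notin> E \<longrightarrow> a i j = 0)) \<and>
     (\<forall>i<n. (\<Sum>j<n. a i j) < 1) \<and>
     (\<forall>i<n. \<forall>h<n. ((i,h) \<in> E \<longrightarrow> 0 < b i h \<and> b i h < 1) \<and> ((i,h) \<notin> E \<longrightarrow> b i h = 0)) \<and>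
     (\<forall>i<n. (\<Sum>h<n. b i h) < 1)"

definition lap_mat :: "nat \<Rightarrow> (nat \<Rightarrow> nat \<Rightarrow> real) \<Rightarrow> real mat" where
  "lap_mat n a = mat n n (\<lambda>(i,j). (if i = j then (\<Sum>k<n. a i k) else 0) - a i j)"

definition S_mat :: "nat \<Rightarrow> (nat \<Rightarrow> nat \<Rightarrow> real) \<Rightarrow> real mat" where
  "S_mat n b = mat n n (\<lambda>(i,j). (if i = j then 1 - (\<Sum>h<n. b i h) else 0) + b j i)"

definition M_mat :: "nat \<Rightarrow> (nat \<Rightarrow> nat \<Rightarrow> real) \<Rightarrow> (nat \<Rightarrow> nat \<Rightarrow> real) \<Rightarrow> real \<Rightarrow> real mat" where
  "M_mat n a b \<epsilon> = four_block_mat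
      (1\<^sub>m n - lap_mat n a) (\<epsilon> \<cdot>\<^sub>m 1\<^sub>m n)
      (lap_mat n a) (S_mat n b - \<epsilon> \<cdot>\<^sub>m 1\<^sub>m n)"

text \<open>Trajectory (x(k), s(k)) stacked, with s(0) = 0.\<close>
primrec traj :: "real mat \<Rightarrow> nat \<Rightarrow> real vec \<Rightarrow> nat \<Rightarrow> real vec" where
  "traj M n x0 0 = x0 @\<^sub>v 0\<^sub>v n"
| "traj M n x0 (Suc k) = M *\<^sub>v traj M n x0 k"

definition average_consensus :: "nat \<Rightarrow> (nat \<Rightarrow> nat \<Rightarrow> real) \<Rightarrow> (nat \<Rightarrow> nat \<Rightarrow> real) \<Rightarrow> real \<Rightarrow> bool" where
  "average_consensus n a b \<epsilon> \<longleftrightarrow>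
     (\<forall>x0 \<in> carrier_vec n.
        let xa = (\<Sum>i<n. x0 $ i) / real n;
            target = vec n (\<lambda>_. xa) @\<^sub>v 0\<^sub>v n
        in \<forall>i < 2 * n. (\<lambda>k. traj (M_mat n a b \<epsilon>) n x0 k $ i) \<longlonglongrightarrow> target $ i)"

end

theory Submission
  imports Defs "Jordan_Normal_Form.Spectral_Radius"
begin

text \<open>
  The vector $v = (\mathbf 1, 0)$ is a right and $w = (\mathbf 1, \mathbf 1)$ a left eigenvector of
  $M$ for the eigenvalue 1, with $w^T v = n$. If 1 is simple and the rest of the spectrum lies in the
  open unit disc, then the deflated matrix $M - v w^T / n$ has spectral radius below 1, and its
  powers drive the error to 0.

  Conversely, assume consensus and let $(y, z)$ be a left eigenvector for $\mu$ with
  $|\mu| \ge 1$. Along a trajectory the pairing with $(y, z)$ is $\mu^k y^T x(0)$, and it converges,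
  so $\mu = 1$ or $y = 0$; applied to a pair of generalised left eigenvectors the same argument
  shows that 1 is simple. The difficulty is $y = 0$, which trajectories with $s(0) = 0$ cannot see:
  there $z^T L = 0$ and $z^T S = (\mu + \epsilon) z^T$. Consensus forces every vertex set without
  incoming edges to be everything, hence the left kernel of $L$ is spanned by one positive vector,
  so $\mu = \sigma - \epsilon$ is real, it is the only eigenvalue besides 1 outside the open disc,
  and it is simple; thus $|\det M| < |\mu|$. But $\det M = \det((I - L) S - \epsilon I)$, where
  $(I - L) S$ is nonnegative with positive left eigenvector $z$ and therefore has spectral radius
  at most $\sigma$, which gives $|\det M| \ge (\epsilon - \sigma)^n = |\mu|^n \ge |\mu|$.
\<close>

no_notation Finite_Cartesian_Product.vec_nth (infixl "$" 90)
no_notation Inner_Product.inner (infix "\<bullet>" 70)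

section \<open>Eigenvalues, powers and determinants of complex matrices\<close>

lemma similar_mat_wit_mult_vec:
  fixes A :: "'a :: comm_ring_1 mat"
  assumes A: "A \<in> carrier_mat n n" and wit: "similar_mat_wit A B P Q" and x: "x \<in> carrier_vec n"
  shows "A *\<^sub>v (P *\<^sub>v x) = P *\<^sub>v (B *\<^sub>v x)"
    and "B *\<^sub>v (Q *\<^sub>v x) = Q *\<^sub>v (A *\<^sub>v x)"
    and "P *\<^sub>v (Q *\<^sub>v x) = x"
    and "Q *\<^sub>v (P *\<^sub>v x) = x"
proof -
  note w = similar_mat_witD2[OF A wit]
  have B: "B \<in> carrier_mat n n" and P: "P \<in> carrier_mat n n" and Q: "Q \<in> carrier_mat n n"
    and PQ: "P * Q = 1\<^sub>m n" and QP: "Q * P = 1\<^sub>m n" and APBQ: "A = P * B * Q"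
    using w by auto
  have "P *\<^sub>v (Q *\<^sub>v x) = (P * Q) *\<^sub>v x" using P Q x by simp
  thus PQx: "P *\<^sub>v (Q *\<^sub>v x) = x" using x by (simp add: PQ)
  have QPy: "Q *\<^sub>v (P *\<^sub>v y) = y" if "y \<in> carrier_vec n" for y
  proof -
    have "Q *\<^sub>v (P *\<^sub>v y) = (Q * P) *\<^sub>v y" using P Q that by simp
    thus ?thesis using that by (simp add: QP)
  qed
  show "Q *\<^sub>v (P *\<^sub>v x) = x" using QPy[OF x] .
  have Ay: "A *\<^sub>v y = P *\<^sub>v (B *\<^sub>v (Q *\<^sub>v y))" if "y \<in> carrier_vec n" for y
  proof -
    have "(P * B * Q) *\<^sub>v y = (P * B) *\<^sub>v (Q *\<^sub>v y)"
      by (rule assoc_mult_mat_vec[of _ n n _ n]) (use P B Q that in auto)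
    also have "\<dots> = P *\<^sub>v (B *\<^sub>v (Q *\<^sub>v y))"
      by (rule assoc_mult_mat_vec[of _ n n _ n]) (use P B Q that in auto)
    finally show ?thesis using APBQ by simp
  qed
  show "A *\<^sub>v (P *\<^sub>v x) = P *\<^sub>v (B *\<^sub>v x)"
    using Ay[of "P *\<^sub>v x"] QPy[OF x] P x by simp
  show "B *\<^sub>v (Q *\<^sub>v x) = Q *\<^sub>v (A *\<^sub>v x)"
    using Ay[OF x] QPy[of "B *\<^sub>v (Q *\<^sub>v x)"] B Q x by simp
qed

text \<open>The vectors are the first two columns of a Schur basis; the Schur form allows any order of the
  roots, and for \<open>e1 = e2\<close> the pair spans a part of the generalised eigenspace.\<close>

lemma char_poly_two_roots_vectors:
  fixes A :: "complex mat"
  assumes A: "A \<in> carrier_mat n n"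
    and cp: "char_poly A = (\<Prod>e \<leftarrow> e1 # e2 # es. [:- e, 1:])"
  obtains p q \<beta> where "p \<in> carrier_vec n" "q \<in> carrier_vec n" "p \<noteq> 0\<^sub>v n"
    "A *\<^sub>v p = e1 \<cdot>\<^sub>v p" "A *\<^sub>v q = e2 \<cdot>\<^sub>v q + \<beta> \<cdot>\<^sub>v p" "\<And>c. q \<noteq> c \<cdot>\<^sub>v p"
proof -
  obtain B P Q where sch: "schur_decomposition A (e1 # e2 # es) = (B, P, Q)"
    by (cases "schur_decomposition A (e1 # e2 # es)") auto
  from schur_decomposition[OF A cp sch]
  have wit: "similar_mat_wit A B P Q" and ut: "upper_triangular B" and dg: "diag_mat B = e1 # e2 # es"
    by auto
  note w = similar_mat_witD2[OF A wit]
  have B: "B \<in> carrier_mat n n" and P: "P \<in> carrier_mat n n" using w by auto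
  have "length (diag_mat B) = n" using B by (simp add: diag_mat_def)
  hence n: "1 < n" using dg by simp
  have diag: "diag_mat B ! i = B $$ (i,i)" if "i < n" for i
    using that B by (simp add: diag_mat_def)
  have B00: "B $$ (0,0) = e1" using diag[of 0] n dg by simp
  have B11: "B $$ (1,1) = e2" using diag[of 1] n dg by simp
  have low: "B $$ (i,j) = 0" if "j < i" "i < n" for i j using ut that B by auto
  define u0 u1 :: "complex vec" where "u0 = unit_vec n 0" and "u1 = unit_vec n 1"
  have u: "u0 \<in> carrier_vec n" "u1 \<in> carrier_vec n" by (auto simp: u0_def u1_def)
  have Bu0: "B *\<^sub>v u0 = e1 \<cdot>\<^sub>v u0"
    using n B low B00 by (intro eq_vecI) (auto simp: u0_def)
  have Bu1: "B *\<^sub>v u1 = e2 \<cdot>\<^sub>v u1 + B $$ (0,1) \<cdot>\<^sub>v u0"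
  proof (rule eq_vecI)
    fix i assume "i < dim_vec (e2 \<cdot>\<^sub>v u1 + B $$ (0,1) \<cdot>\<^sub>v u0)"
    hence i: "i < n" using u by simp
    consider "i = 0" | "i = 1" | "1 < i" by linarith
    thus "(B *\<^sub>v u1) $ i = (e2 \<cdot>\<^sub>v u1 + B $$ (0,1) \<cdot>\<^sub>v u0) $ i"
      by cases (use n B B11 low i in \<open>auto simp: u0_def u1_def\<close>)
  qed (use B u in auto)
  note sim = similar_mat_wit_mult_vec[OF A wit]
  show ?thesis
  proof (rule that[of "P *\<^sub>v u0" "P *\<^sub>v u1" "B $$ (0,1)"])
    show "P *\<^sub>v u0 \<in> carrier_vec n" "P *\<^sub>v u1 \<in> carrier_vec n" using P u by auto
    show "A *\<^sub>v (P *\<^sub>v u0) = e1 \<cdot>\<^sub>v (P *\<^sub>v u0)"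
      using P u by (simp add: sim(1) Bu0 mult_mat_vec)
    show "A *\<^sub>v (P *\<^sub>v u1) = e2 \<cdot>\<^sub>v (P *\<^sub>v u1) + B $$ (0,1) \<cdot>\<^sub>v (P *\<^sub>v u0)"
      using P u by (simp add: sim(1) Bu1 mult_mat_vec mult_add_distrib_mat_vec[OF P])
    have Q: "Q \<in> carrier_mat n n" using w by auto
    show "P *\<^sub>v u0 \<noteq> 0\<^sub>v n"
    proof
      assume "P *\<^sub>v u0 = 0\<^sub>v n"
      hence "u0 = Q *\<^sub>v 0\<^sub>v n" using sim(4)[OF u(1)] by simp
      hence "u0 $ 0 = 0" using n Q by (simp add: scalar_prod_def)
      thus False using n by (simp add: u0_def)
    qed
    show "P *\<^sub>v u1 \<noteq> c \<cdot>\<^sub>v (P *\<^sub>v u0)" for c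
    proof
      assume "P *\<^sub>v u1 = c \<cdot>\<^sub>v (P *\<^sub>v u0)"
      hence "Q *\<^sub>v (P *\<^sub>v u1) = Q *\<^sub>v (c \<cdot>\<^sub>v (P *\<^sub>v u0))" by simp
      hence "u1 = c \<cdot>\<^sub>v u0" using sim(4)[OF u(1)] sim(4)[OF u(2)] Q P u by (simp add: mult_mat_vec)
      hence "u1 $ 1 = (c \<cdot>\<^sub>v u0) $ 1" by simp
      thus False using n by (simp add: u0_def u1_def)
    qed
  qed
qed

text \<open>\<open>schur_decomposition\<close> puts the roots on the diagonal in the order of the
  given list. Permuting the factors therefore brings chosen roots to the front.\<close>

lemma prod_list_linear_reorder:
  assumes "mset as = mset bs"
  shows "(\<Prod>a \<leftarrow> as. [:- a, 1:]) = (\<Prod>a \<leftarrow> bs. [:- a, 1 :: 'a :: comm_ring_1:])"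
  using assms by (metis mset_map prod_mset_prod_list)

text \<open>Turns algebraic multiplicity into counting in a root list, the form in which the Schur
  decomposition takes its roots.\<close>

lemma order_prod_linear:
  "order x (\<Prod>a \<leftarrow> as. [:- a, 1 :: 'a :: field:]) = count (mset as) x"
proof (induction as)
  case (Cons b as)
  have "(\<Prod>a \<leftarrow> as. [:- a, 1 :: 'a :: field:]) \<noteq> 0" by (auto simp: prod_list_zero_iff)
  moreover have "order x [:- b, 1:] = (if x = b then 1 else 0)"
    using order_linear_power[of x "- b" 1] by auto
  ultimately show ?case
    using Cons.IH by (simp add: order_mult del: mult_pCons_left)
qed (simp add: order_0I)

text \<open>In a Schur form with \<open>\<mu>\<close> listed first, no later diagonal entry equals
  \<open>\<mu>\<close>. Back substitution then kills every coordinate of an eigenvector except the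
  first, so all eigenvectors lie on one line.\<close>

lemma simple_eigenvalue_eigenvectors_proportional:
  fixes A :: "complex mat"
  assumes A: "A \<in> carrier_mat n n" and ord: "order \<mu> (char_poly A) = 1"
    and v: "v \<in> carrier_vec n" "v \<noteq> 0\<^sub>v n" "A *\<^sub>v v = \<mu> \<cdot>\<^sub>v v"
    and u: "u \<in> carrier_vec n" "A *\<^sub>v u = \<mu> \<cdot>\<^sub>v u"
  shows "\<exists>c. u = c \<cdot>\<^sub>v v"
proof -
  obtain as where cpa: "char_poly A = (\<Prod>a \<leftarrow> as. [:- a, 1:])"
    using char_poly_factorized[OF A] by blast
  have cnt: "count (mset as) \<mu> = 1" using ord unfolding cpa order_prod_linear .
  hence mem: "\<mu> \<in># mset as" by (metis count_inI zero_neq_one)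
  obtain rest where rest: "mset as = mset (\<mu> # rest)"
    using mem by (metis ex_mset insert_DiffM mset.simps(2))
  have nin: "\<mu> \<notin> set rest" using cnt unfolding rest by (simp add: count_eq_zero_iff)
  have cp: "char_poly A = (\<Prod>a \<leftarrow> \<mu> # rest. [:- a, 1:])"
    unfolding cpa by (rule prod_list_linear_reorder[OF rest])
  obtain B P Q where sch: "schur_decomposition A (\<mu> # rest) = (B, P, Q)"
    by (cases "schur_decomposition A (\<mu> # rest)") auto
  from schur_decomposition[OF A cp sch]
  have wit: "similar_mat_wit A B P Q" and ut: "upper_triangular B" and dg: "diag_mat B = \<mu> # rest"
    by auto
  note w = similar_mat_witD2[OF A wit]
  have B: "B \<in> carrier_mat n n" and P: "P \<in> carrier_mat n n" and Q: "Q \<in> carrier_mat n n"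
    using w by auto
  have len: "length (diag_mat B) = n" using B by (simp add: diag_mat_def)
  hence n: "0 < n" using dg by simp
  have diag: "diag_mat B ! i = B $$ (i,i)" if "i < n" for i
    using that B by (simp add: diag_mat_def)
  have Bii: "B $$ (i,i) \<noteq> \<mu>" if "0 < i" "i < n" for i
  proof -
    have "(\<mu> # rest) ! i \<in> set rest" using that len dg by (cases i) auto
    thus ?thesis using diag[OF that(2)] dg nin by auto
  qed
  have low: "B $$ (i,j) = 0" if "j < i" "i < n" for i j using ut that B by auto
  note sim = similar_mat_wit_mult_vec[OF A wit]
  have zero: "(Q *\<^sub>v x) $ i = 0"
    if x: "x \<in> carrier_vec n" "A *\<^sub>v x = \<mu> \<cdot>\<^sub>v x" and i: "0 < i" "i < n" for x i
  proof (rule ccontr)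
    define y where "y = Q *\<^sub>v x"
    have y: "y \<in> carrier_vec n" using Q x by (simp add: y_def)
    have By: "B *\<^sub>v y = \<mu> \<cdot>\<^sub>v y"
      using Q x by (simp add: y_def sim(2) mult_mat_vec)
    assume "(Q *\<^sub>v x) $ i \<noteq> 0"
    hence "i \<in> {j. j < n \<and> y $ j \<noteq> 0}" using i by (simp add: y_def)
    \<comment> \<open>At the last nonzero coordinate, triangularity reduces the eigenvalue equation
      to its diagonal term, which forces \<open>B $$ (m,m) = \<mu>\<close>.\<close>
    define m where "m = Max {j. j < n \<and> y $ j \<noteq> 0}"
    have fin: "finite {j. j < n \<and> y $ j \<noteq> 0}" by simp
    have "m \<in> {j. j < n \<and> y $ j \<noteq> 0}" unfolding m_def
      using fin \<open>i \<in> _\<close> by (intro Max_in) auto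
    hence m: "m < n" "y $ m \<noteq> 0" by auto
    have im: "i \<le> m" unfolding m_def using fin \<open>i \<in> _\<close> by (rule Max_ge)
    have big: "y $ j = 0" if "m < j" "j < n" for j
      using that Max_ge[OF fin, of j] unfolding m_def by fastforce
    have "(B *\<^sub>v y) $ m = (\<Sum>j = 0..<n. B $$ (m,j) * y $ j)"
      using B y m by (simp add: scalar_prod_def)
    also have "\<dots> = (\<Sum>j \<in> {m}. B $$ (m,j) * y $ j)"
    proof (rule sum.mono_neutral_right)
      show "\<forall>j \<in> {0..<n} - {m}. B $$ (m,j) * y $ j = 0"
      proof
        fix j assume "j \<in> {0..<n} - {m}"
        hence "j < m \<or> (m < j \<and> j < n)" by auto
        thus "B $$ (m,j) * y $ j = 0" using low[of j m] big[of j] m by auto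
      qed
    qed (use m in auto)
    finally have "B $$ (m,m) * y $ m = \<mu> * y $ m" using By y m by simp
    thus False using m Bii[of m] im i by simp
  qed
  have Qx: "Q *\<^sub>v x = (Q *\<^sub>v x) $ 0 \<cdot>\<^sub>v unit_vec n 0"
    if "x \<in> carrier_vec n" "A *\<^sub>v x = \<mu> \<cdot>\<^sub>v x" for x
  proof (rule eq_vecI)
    fix i assume "i < dim_vec ((Q *\<^sub>v x) $ 0 \<cdot>\<^sub>v unit_vec n 0)"
    hence "i < n" by simp
    thus "(Q *\<^sub>v x) $ i = ((Q *\<^sub>v x) $ 0 \<cdot>\<^sub>v unit_vec n 0) $ i"
      using zero[OF that, of i] n by (cases "i = 0") auto
  qed (use Q in auto)
  define cu cv where "cu = (Q *\<^sub>v u) $ 0" and "cv = (Q *\<^sub>v v) $ 0"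
  define e where "e = P *\<^sub>v unit_vec n 0"
  have rep: "x = (Q *\<^sub>v x) $ 0 \<cdot>\<^sub>v e"
    if "x \<in> carrier_vec n" "A *\<^sub>v x = \<mu> \<cdot>\<^sub>v x" for x
  proof -
    have "x = P *\<^sub>v (Q *\<^sub>v x)" using sim(3)[OF that(1)] by simp
    also have "\<dots> = P *\<^sub>v ((Q *\<^sub>v x) $ 0 \<cdot>\<^sub>v unit_vec n 0)" using Qx[OF that] by simp
    also have "\<dots> = (Q *\<^sub>v x) $ 0 \<cdot>\<^sub>v e" unfolding e_def by (rule mult_mat_vec[OF P]) simp
    finally show ?thesis .
  qed
  have e: "e \<in> carrier_vec n" using P by (simp add: e_def)
  have Pu: "u = cu \<cdot>\<^sub>v e" and Pv: "v = cv \<cdot>\<^sub>v e"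
    using rep[OF u] rep[OF v(1,3)] by (simp_all add: cu_def cv_def)
  have "cv \<noteq> 0"
  proof
    assume "cv = 0"
    hence "v = 0\<^sub>v n" unfolding Pv using e by (intro eq_vecI) auto
    thus False using v by simp
  qed
  have "u = (cu / cv) \<cdot>\<^sub>v v"
    by (subst Pu, subst Pv) (use \<open>cv \<noteq> 0\<close> in \<open>simp add: smult_smult_assoc\<close>)
  thus ?thesis by blast
qed

section \<open>Decay of powers, determinant bounds and a Perron-type estimate\<close>

lemma mult_smult_mat_vec:
  assumes "A \<in> carrier_mat m n" "v \<in> carrier_vec n"
  shows "(k \<cdot>\<^sub>m A) *\<^sub>v v = k \<cdot>\<^sub>v (A *\<^sub>v (v :: 'a :: comm_ring_1 vec))"
  using assms by (intro eq_vecI) auto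

text \<open>Dividing \<open>A\<close> by some \<open>r\<close> strictly between its spectral radius
  and 1 leaves a matrix of spectral radius below 1, whose powers are bounded. Hence the entries of
  the powers of \<open>A\<close> are of order \<open>r ^ k\<close>.\<close>

lemma pow_mat_tendsto_zero:
  fixes A :: "complex mat"
  assumes A: "A \<in> carrier_mat n n" and ev: "\<And>z. eigenvalue A z \<Longrightarrow> cmod z < 1"
    and ij: "i < n" "j < n"
  shows "(\<lambda>k. (A ^\<^sub>m k) $$ (i,j)) \<longlonglongrightarrow> 0"
proof -
  have n: "0 < n" using ij by simp
  have "spectral_radius A \<in> cmod ` spectrum A" by (rule spectral_radius_mem_max(1)[OF A n])
  hence "0 \<le> spectral_radius A" "spectral_radius A < 1" using ev by (auto simp: spectrum_def)
  then obtain r where r: "spectral_radius A < r" "r < 1" "0 < r"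
    by (meson dense order_le_less_trans)
  define C where "C = complex_of_real (1 / r) \<cdot>\<^sub>m A"
  have C: "C \<in> carrier_mat n n" using A by (simp add: C_def)
  have evC: "cmod z < 1" if z: "eigenvalue C z" for z
  proof -
    obtain x where x: "x \<in> carrier_vec n" "x \<noteq> 0\<^sub>v n" "C *\<^sub>v x = z \<cdot>\<^sub>v x"
      using z C by (auto simp: eigenvalue_def eigenvector_def)
    have "A = of_real r \<cdot>\<^sub>m C" using A r unfolding C_def by (intro eq_matI) auto
    hence "A *\<^sub>v x = of_real r \<cdot>\<^sub>v (z \<cdot>\<^sub>v x)"
      using mult_smult_mat_vec[OF C x(1)] x by simp
    hence "eigenvalue A (of_real r * z)" using x A
      unfolding eigenvalue_def eigenvector_def by (auto simp: smult_smult_assoc)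
    hence "cmod (of_real r * z) \<le> spectral_radius A"
      by (intro spectral_radius_mem_max(2)[OF A n]) (auto simp: spectrum_def)
    hence "r * cmod z \<le> spectral_radius A" using r by (simp add: norm_mult)
    hence "r * cmod z < r * 1" using r by linarith
    thus ?thesis using r by (simp only: mult_less_cancel_left_pos)
  qed
  have "spectral_radius C < 1"
    using spectral_radius_mem_max(1)[OF C n] evC by (auto simp: spectrum_def)
  then obtain c where c: "\<And>k. norm_bound (C ^\<^sub>m k) c"
    using spectral_radius_jnf_norm_bound_less_1_upper_triangular[OF C] by blast
  have pow: "A ^\<^sub>m k = of_real (r ^ k) \<cdot>\<^sub>m (C ^\<^sub>m k)" for k
  proof (induction k)
    case 0
    then show ?case using A C by (intro eq_matI) auto
  next
    case (Suc k)
    have Ck: "C ^\<^sub>m k \<in> carrier_mat n n" using C by simp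
    have "A = of_real r \<cdot>\<^sub>m C" using A r unfolding C_def by (intro eq_matI) auto
    hence "A ^\<^sub>m Suc k = (of_real (r ^ k) \<cdot>\<^sub>m (C ^\<^sub>m k)) * (of_real r \<cdot>\<^sub>m C)" using Suc by simp
    also have "\<dots> = of_real (r ^ k) \<cdot>\<^sub>m (of_real r \<cdot>\<^sub>m (C ^\<^sub>m k * C))"
      using mult_smult_assoc_mat[OF Ck, of "of_real r \<cdot>\<^sub>m C" n "of_real (r ^ k)"]
        mult_smult_distrib[OF Ck C, of "of_real r"] C by (simp only: smult_carrier_mat)
    also have "\<dots> = of_real (r ^ Suc k) \<cdot>\<^sub>m (C ^\<^sub>m Suc k)"
      using Ck C by (intro eq_matI) auto
    finally show ?case .
  qed
  have bd: "cmod ((A ^\<^sub>m k) $$ (i,j)) \<le> c * r ^ k" for k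
  proof -
    have Ck: "C ^\<^sub>m k \<in> carrier_mat n n" using C by simp
    have "cmod ((C ^\<^sub>m k) $$ (i,j)) \<le> c" using c[of k] C ij by (auto simp: norm_bound_def)
    hence "r ^ k * cmod ((C ^\<^sub>m k) $$ (i,j)) \<le> r ^ k * c" using r by (intro mult_left_mono) auto
    moreover have "(A ^\<^sub>m k) $$ (i,j) = of_real (r ^ k) * (C ^\<^sub>m k) $$ (i,j)"
      unfolding pow using C ij by (subst index_smult_mat) auto
    hence "cmod ((A ^\<^sub>m k) $$ (i,j)) = r ^ k * cmod ((C ^\<^sub>m k) $$ (i,j))"
      using r by (simp add: norm_mult norm_power)
    ultimately show ?thesis by (simp add: mult.commute)
  qed
  have "(\<lambda>k. c * r ^ k) \<longlonglongrightarrow> c * 0"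
    by (intro tendsto_mult tendsto_const LIMSEQ_realpow_zero) (use r in auto)
  hence "(\<lambda>k. c * r ^ k) \<longlonglongrightarrow> 0" by simp
  thus ?thesis by (rule Lim_null_comparison[rotated]) (simp add: bd)
qed

lemma det_eq_prod_list_roots:
  fixes A :: "complex mat"
  assumes A: "A \<in> carrier_mat n n" and cp: "char_poly A = (\<Prod>e \<leftarrow> es. [:- e, 1:])"
  shows "det A = prod_list es"
proof -
  obtain B P Q where sch: "schur_decomposition A es = (B, P, Q)"
    by (cases "schur_decomposition A es") auto
  from schur_decomposition[OF A cp sch]
  have wit: "similar_mat_wit A B P Q" and ut: "upper_triangular B" and dg: "diag_mat B = es"
    by auto
  have "B \<in> carrier_mat n n" using similar_mat_witD2[OF A wit] by auto
  moreover have "det A = det B" using wit by (intro det_similar) (auto simp: similar_mat_def)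
  ultimately show ?thesis using det_upper_triangular[OF ut] dg by simp
qed

lemma norm_det_ge_power:
  fixes A :: "complex mat"
  assumes A: "A \<in> carrier_mat n n" and r: "0 \<le> r"
    and ev: "\<And>z. eigenvalue A z \<Longrightarrow> r \<le> cmod z"
  shows "r ^ n \<le> cmod (det A)"
proof -
  obtain es where cp: "char_poly A = (\<Prod>e \<leftarrow> es. [:- e, 1:])" and len: "length es = n"
    using char_poly_factorized[OF A] by blast
  have "r \<le> cmod e" if "e \<in> set es" for e
    using that linear_poly_root[of e es] unfolding cp[symmetric]
    by (intro ev) (simp add: eigenvalue_root_char_poly[OF A])
  hence "r ^ length es \<le> cmod (prod_list es)"
    by (induction es) (auto simp: norm_mult r intro!: mult_mono)
  thus ?thesis using det_eq_prod_list_roots[OF A cp] len by simp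
qed

text \<open>The positive left eigenvector \<open>z\<close> provides a weighted 1-norm. Taking moduli
  in the eigenvalue equation and pairing with \<open>z\<close> gives
  \<open>cmod \<tau> * m \<le> \<sigma> * m\<close>, where \<open>m\<close> is the norm of the
  eigenvector.\<close>

lemma nonneg_mat_eigenvalue_bound:
  fixes N :: "real mat" and z :: "nat \<Rightarrow> real"
  assumes N: "N \<in> carrier_mat n n"
    and nonneg: "\<And>i j. i < n \<Longrightarrow> j < n \<Longrightarrow> 0 \<le> N $$ (i,j)"
    and z: "\<And>i. i < n \<Longrightarrow> 0 < z i"
    and zN: "\<And>j. j < n \<Longrightarrow> (\<Sum>i<n. z i * N $$ (i,j)) = \<sigma> * z j"
    and ev: "eigenvalue (map_mat complex_of_real N) \<tau>"
  shows "cmod \<tau> \<le> \<sigma>"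
proof -
  obtain x where x: "x \<in> carrier_vec n" "x \<noteq> 0\<^sub>v n"
    and Nx: "map_mat complex_of_real N *\<^sub>v x = \<tau> \<cdot>\<^sub>v x"
    using ev N by (auto simp: eigenvalue_def eigenvector_def)
  have comp: "\<tau> * x $ i = (\<Sum>j<n. of_real (N $$ (i,j)) * x $ j)" if "i < n" for i
  proof -
    have "\<tau> * x $ i = (\<tau> \<cdot>\<^sub>v x) $ i" using x that by simp
    also have "\<dots> = (\<Sum>j<n. of_real (N $$ (i,j)) * x $ j)"
      unfolding Nx[symmetric] using N x that
      by (simp add: scalar_prod_def lessThan_atLeast0)
    finally show ?thesis .
  qed
  have le: "cmod \<tau> * cmod (x $ i) \<le> (\<Sum>j<n. N $$ (i,j) * cmod (x $ j))" if "i < n" for i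
  proof -
    have "cmod \<tau> * cmod (x $ i) \<le> (\<Sum>j<n. cmod (of_real (N $$ (i,j)) * x $ j))"
      unfolding norm_mult[symmetric] comp[OF that] by (rule norm_sum)
    also have "\<dots> = (\<Sum>j<n. N $$ (i,j) * cmod (x $ j))"
      using nonneg that by (intro sum.cong) (auto simp: norm_mult)
    finally show ?thesis .
  qed
  define m where "m = (\<Sum>i<n. z i * cmod (x $ i))"
  obtain i where i: "i < n" "x $ i \<noteq> 0" using x by (metis carrier_vecD eq_vecI index_zero_vec)
  have "0 < z i * cmod (x $ i)" using i z by simp
  also have "\<dots> \<le> m" unfolding m_def
    using i z by (intro member_le_sum) (auto intro!: mult_nonneg_nonneg less_imp_le[OF z])
  finally have m: "0 < m" .
  have "cmod \<tau> * m = (\<Sum>i<n. z i * (cmod \<tau> * cmod (x $ i)))"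
    by (simp add: m_def sum_distrib_left mult_ac)
  also have "\<dots> \<le> (\<Sum>i<n. z i * (\<Sum>j<n. N $$ (i,j) * cmod (x $ j)))"
    using le z by (intro sum_mono mult_left_mono) (auto intro: less_imp_le)
  also have "\<dots> = (\<Sum>j<n. (\<Sum>i<n. z i * N $$ (i,j)) * cmod (x $ j))"
    unfolding sum_distrib_left sum_distrib_right by (subst sum.swap) (simp add: mult_ac)
  also have "\<dots> = \<sigma> * m"
    using zN by (simp add: m_def sum_distrib_left mult_ac)
  finally show ?thesis using m by simp
qed

section \<open>The surplus-based averaging algorithm\<close>

lemma sum_lessThan_double:
  "(\<Sum>i<2 * n. f i) = (\<Sum>i<n. f i) + (\<Sum>i<n. f (n + i :: nat) :: 'a :: comm_monoid_add)"
proof -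
  have "(\<Sum>i<n + m. f i) = (\<Sum>i<n. f i) + (\<Sum>i<m. f (n + i))" for m
    by (induction m) (simp_all add: add.assoc)
  thus ?thesis by (simp add: mult_2)
qed

lemma less_double_cases:
  fixes i n :: nat
  assumes "i < 2 * n"
  obtains "i < n" | j where "j < n" "i = n + j"
proof (cases "i < n")
  case False
  with that(2)[of "i - n"] assms show ?thesis by simp
qed

text \<open>Consecutive differences of a convergent sequence tend to 0, whereas here their moduli
  never drop below the modulus of \<open>(\<mu> - 1) * c\<close>.\<close>

lemma power_mult_convergent_imp:
  fixes \<mu> c :: complex
  assumes lim: "(\<lambda>k. \<mu> ^ k * c) \<longlonglongrightarrow> l" and \<mu>: "1 \<le> cmod \<mu>" "\<mu> \<noteq> 1"
  shows "c = 0"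
proof (rule ccontr)
  assume c: "c \<noteq> 0"
  have "(\<lambda>k. \<mu> ^ Suc k * c - \<mu> ^ k * c) \<longlonglongrightarrow> l - l"
    by (intro tendsto_diff lim LIMSEQ_Suc[OF lim])
  hence "(\<lambda>k. norm (\<mu> ^ Suc k * c - \<mu> ^ k * c)) \<longlonglongrightarrow> 0"
    by (intro tendsto_norm_zero) simp
  moreover have "cmod ((\<mu> - 1) * c) \<le> norm (\<mu> ^ Suc k * c - \<mu> ^ k * c)" for k
  proof -
    have "\<mu> ^ Suc k * c - \<mu> ^ k * c = \<mu> ^ k * ((\<mu> - 1) * c)" by (simp add: algebra_simps)
    moreover have "1 \<le> cmod \<mu> ^ k" using \<mu> by simp
    ultimately show ?thesis
      using mult_right_mono[of 1 "cmod \<mu> ^ k" "cmod ((\<mu> - 1) * c)"]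
      by (simp add: norm_mult norm_power)
  qed
  ultimately have "cmod ((\<mu> - 1) * c) \<le> 0"
    by (intro LIMSEQ_le_const) auto
  thus False using \<mu> c by simp
qed

locale surplus_algorithm =
  fixes n :: nat and E :: "(nat \<times> nat) set" and a b :: "nat \<Rightarrow> nat \<Rightarrow> real" and \<epsilon> :: real
  assumes n: "n > 1" and weights: "weights_ok n E a b" and eps: "\<epsilon> > 0"
begin

text \<open>The blocks are restated as entry functions, so that the block equations of
  \<open>M\<close> become plain sums over vertices. \<open>P\<close> below is the upper left
  block.\<close>

definition L :: "nat \<Rightarrow> nat \<Rightarrow> real" where
  "L i j = (if i = j then (\<Sum>k<n. a i k) else 0) - a i j"

definition P :: "nat \<Rightarrow> nat \<Rightarrow> real" where
  "P i j = (if i = j then 1 else 0) - L i j"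

definition S :: "nat \<Rightarrow> nat \<Rightarrow> real" where
  "S i j = (if i = j then 1 - (\<Sum>h<n. b i h) else 0) + b j i"

abbreviation M :: "real mat" where "M \<equiv> M_mat n a b \<epsilon>"

abbreviation Mc :: "complex mat" where "Mc \<equiv> map_mat complex_of_real M"

section \<open>Weights, stochasticity and the entries of \<open>M\<close>\<close>

lemma a_pos: "i < n \<Longrightarrow> j < n \<Longrightarrow> (j, i) \<in> E \<Longrightarrow> 0 < a i j"
  using weights unfolding weights_ok_def by blast

lemma a_eq_0: "i < n \<Longrightarrow> j < n \<Longrightarrow> (j, i) \<notin> E \<Longrightarrow> a i j = 0"
  using weights unfolding weights_ok_def by blast

lemma b_eq_0: "i < n \<Longrightarrow> j < n \<Longrightarrow> (i, j) \<notin> E \<Longrightarrow> b i j = 0"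
  using weights unfolding weights_ok_def by blast

lemma a_nonneg: "i < n \<Longrightarrow> j < n \<Longrightarrow> 0 \<le> a i j"
  using a_pos[of i j] a_eq_0[of i j] by (cases "(j, i) \<in> E") auto

lemma b_nonneg: "i < n \<Longrightarrow> j < n \<Longrightarrow> 0 \<le> b i j"
  using weights unfolding weights_ok_def by (cases "(i, j) \<in> E") (auto simp: less_imp_le)

lemma a_sum_less: "i < n \<Longrightarrow> (\<Sum>j<n. a i j) < 1"
  using weights unfolding weights_ok_def by blast

lemma b_sum_less: "i < n \<Longrightarrow> (\<Sum>j<n. b i j) < 1"
  using weights unfolding weights_ok_def by blast

text \<open>The diagonal is nonnegative because the weights in each row sum to less than 1. With the
  sums below, \<open>P\<close> is row stochastic and \<open>S\<close> column stochastic.\<close>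

lemma P_nonneg: "i < n \<Longrightarrow> j < n \<Longrightarrow> 0 \<le> P i j"
  using a_sum_less[of i] a_nonneg[of i j] by (auto simp: P_def L_def)

lemma S_nonneg: "i < n \<Longrightarrow> j < n \<Longrightarrow> 0 \<le> S i j"
  using b_sum_less[of i] b_nonneg[of j i] by (auto simp: S_def)

lemma L_row_sum: "i < n \<Longrightarrow> (\<Sum>j<n. L i j) = 0"
  by (simp add: L_def sum_subtractf)

lemma P_row_sum: "i < n \<Longrightarrow> (\<Sum>j<n. P i j) = 1"
  by (simp add: P_def sum_subtractf L_row_sum)

lemma S_col_sum: "j < n \<Longrightarrow> (\<Sum>i<n. S i j) = 1"
  by (simp add: S_def sum.distrib)

lemma M_carrier [simp]: "M \<in> carrier_mat (2 * n) (2 * n)"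
  unfolding M_mat_def mult_2
  by (rule four_block_carrier_mat) (auto simp: lap_mat_def S_mat_def)

lemma Mc_carrier [simp]: "Mc \<in> carrier_mat (2 * n) (2 * n)"
  by simp

lemma M_dim [simp]: "dim_row M = 2 * n" "dim_col M = 2 * n"
  using M_carrier unfolding carrier_mat_def by simp_all

lemma M_entries:
  assumes "i < n" "j < n"
  shows "M $$ (i, j) = P i j"
    and "M $$ (i, n + j) = (if i = j then \<epsilon> else 0)"
    and "M $$ (n + i, j) = L i j"
    and "M $$ (n + i, n + j) = S i j - (if i = j then \<epsilon> else 0)"
  using assms by (simp_all add: M_mat_def lap_mat_def S_mat_def P_def L_def S_def)

lemma mult_M_index:
  assumes q: "q \<in> carrier_vec (2 * n)" and i: "i < n"
  shows "(M *\<^sub>v q) $ i = (\<Sum>j<n. P i j * q $ j) + \<epsilon> * q $ (n + i)"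
    and "(M *\<^sub>v q) $ (n + i) = (\<Sum>j<n. L i j * q $ j) + (\<Sum>j<n. S i j * q $ (n + j)) - \<epsilon> * q $ (n + i)"
proof -
  have *: "(M *\<^sub>v q) $ k = (\<Sum>j<n. M $$ (k,j) * q $ j) + (\<Sum>j<n. M $$ (k,n+j) * q $ (n+j))"
    if "k < 2 * n" for k
    using that q by (simp add: scalar_prod_def atLeast0LessThan sum_lessThan_double)
  show "(M *\<^sub>v q) $ i = (\<Sum>j<n. P i j * q $ j) + \<epsilon> * q $ (n + i)"
    using i by (subst *) (simp_all add: M_entries if_distrib[of "\<lambda>x. x * _"] cong: if_cong)
  show "(M *\<^sub>v q) $ (n + i) = (\<Sum>j<n. L i j * q $ j) + (\<Sum>j<n. S i j * q $ (n + j)) - \<epsilon> * q $ (n + i)"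
    using i by (subst *) (simp_all add: M_entries left_diff_distrib sum_subtractf
      if_distrib[of "\<lambda>x. x * _"] cong: if_cong)
qed

lemma mult_Mc_transpose_index:
  assumes q: "q \<in> carrier_vec (2 * n)" and j: "j < n"
  shows "(Mc\<^sup>T *\<^sub>v q) $ j = (\<Sum>i<n. of_real (P i j) * q $ i) + (\<Sum>i<n. of_real (L i j) * q $ (n + i))"
    and "(Mc\<^sup>T *\<^sub>v q) $ (n + j) = of_real \<epsilon> * q $ j + (\<Sum>i<n. of_real (S i j) * q $ (n + i))
      - of_real \<epsilon> * q $ (n + j)"
proof -
  have *: "(Mc\<^sup>T *\<^sub>v q) $ k = (\<Sum>i<n. of_real (M $$ (i,k)) * q $ i) + (\<Sum>i<n. of_real (M $$ (n+i,k)) * q $ (n+i))"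
    if "k < 2 * n" for k
    using that q by (simp add: scalar_prod_def atLeast0LessThan sum_lessThan_double)
  show "(Mc\<^sup>T *\<^sub>v q) $ j = (\<Sum>i<n. of_real (P i j) * q $ i) + (\<Sum>i<n. of_real (L i j) * q $ (n + i))"
    using j by (subst *) (simp_all add: M_entries)
  show "(Mc\<^sup>T *\<^sub>v q) $ (n + j) = of_real \<epsilon> * q $ j + (\<Sum>i<n. of_real (S i j) * q $ (n + i))
      - of_real \<epsilon> * q $ (n + j)"
    using j by (subst *) (simp_all add: M_entries left_diff_distrib sum_subtractf
      if_distrib[of "\<lambda>x. x * _"] if_distrib[of complex_of_real] cong: if_cong)
qed

text \<open>Conservation of the total of states and surpluses: \<open>P\<close> and \<open>L\<close>
  add up to the identity, and the two occurrences of \<open>\<epsilon>\<close> cancel.\<close>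

lemma M_col_sum:
  assumes "j < 2 * n"
  shows "(\<Sum>i<2 * n. M $$ (i,j)) = 1"
  using assms
proof (cases rule: less_double_cases)
  case 1
  have "(\<Sum>i<2 * n. M $$ (i,j)) = (\<Sum>i<n. P i j) + (\<Sum>i<n. L i j)"
    using 1 by (simp add: sum_lessThan_double M_entries)
  also have "\<dots> = (\<Sum>i<n. if i = j then 1 else 0)"
    unfolding sum.distrib[symmetric] by (simp add: P_def)
  finally show ?thesis using 1 by simp
next
  case (2 k)
  thus ?thesis by (simp add: sum_lessThan_double M_entries sum_subtractf S_col_sum)
qed

section \<open>Trajectories and their pairings with left vectors\<close>

lemma traj_carrier [simp]:
  assumes "x0 \<in> carrier_vec n"
  shows "traj M n x0 k \<in> carrier_vec (2 * n)"
proof (induction k)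
  case 0
  show ?case using assms by (simp add: mult_2)
next
  case (Suc k)
  thus ?case using mult_mat_vec_carrier[OF M_carrier] by simp
qed


text \<open>Complexified, so that the bilinear product (without conjugation) can pair trajectories
  with complex left eigenvectors.\<close>

definition state :: "real vec \<Rightarrow> nat \<Rightarrow> complex vec" where
  "state x0 k = map_vec complex_of_real (traj M n x0 k)"

lemma state_carrier [simp]: "x0 \<in> carrier_vec n \<Longrightarrow> state x0 k \<in> carrier_vec (2 * n)"
  by (simp add: state_def)

lemma state_Suc: "x0 \<in> carrier_vec n \<Longrightarrow> state x0 (Suc k) = Mc *\<^sub>v state x0 k"
  unfolding state_def traj.simps
  by (rule of_real_hom.mult_mat_vec_hom[OF M_carrier]) simp

text \<open>Moves one step of the dynamics onto the covector; left eigenvectors of \<open>Mc\<close>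
  are treated throughout as eigenvectors of its transpose.\<close>

lemma scalar_prod_state_Suc:
  assumes "x0 \<in> carrier_vec n" "q \<in> carrier_vec (2 * n)"
  shows "q \<bullet> state x0 (Suc k) = (Mc\<^sup>T *\<^sub>v q) \<bullet> state x0 k"
  unfolding state_Suc[OF assms(1)]
  by (rule transpose_vec_mult_scalar[symmetric, OF Mc_carrier]) (use assms in auto)

text \<open>The surplus starts at 0, so only the upper half of \<open>q\<close> counts. This is why
  left eigenvectors with zero upper half are invisible to trajectories.\<close>

lemma scalar_prod_state_0:
  assumes "x0 \<in> carrier_vec n" "q \<in> carrier_vec (2 * n)"
  shows "q \<bullet> state x0 0 = (\<Sum>i<n. q $ i * of_real (x0 $ i))"
proof -
  have "q \<bullet> state x0 0 = (\<Sum>i<2 * n. q $ i * state x0 0 $ i)"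
    using carrier_vecD[OF state_carrier[OF assms(1), of 0]]
    by (simp add: scalar_prod_def atLeast0LessThan)
  thus ?thesis using assms by (simp add: sum_lessThan_double state_def)
qed

lemma scalar_prod_state_tendsto:
  assumes cons: "average_consensus n a b \<epsilon>"
    and x0: "x0 \<in> carrier_vec n" and q: "q \<in> carrier_vec (2 * n)"
  shows "(\<lambda>k. q \<bullet> state x0 k) \<longlonglongrightarrow> (\<Sum>i<n. q $ i) * of_real ((\<Sum>i<n. x0 $ i) / real n)"
proof -
  define xa where "xa = (\<Sum>i<n. x0 $ i) / real n"
  define target where "target = vec n (\<lambda>_. xa) @\<^sub>v 0\<^sub>v n"
  have conv: "(\<lambda>k. traj M n x0 k $ i) \<longlonglongrightarrow> target $ i" if "i < 2 * n" for i
    using cons x0 that unfolding average_consensus_def Let_def target_def xa_def by blast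
  have "q \<bullet> state x0 k = (\<Sum>i<2 * n. q $ i * of_real (traj M n x0 k $ i))" for k
    using traj_carrier[OF x0, of k] q by (simp add: state_def scalar_prod_def atLeast0LessThan)
  moreover have "(\<lambda>k. \<Sum>i<2 * n. q $ i * of_real (traj M n x0 k $ i)) \<longlonglongrightarrow>
      (\<Sum>i<2 * n. q $ i * of_real (target $ i))"
    by (intro tendsto_sum tendsto_mult tendsto_const tendsto_of_real conv) simp
  moreover have "(\<Sum>i<2 * n. q $ i * of_real (target $ i)) = (\<Sum>i<n. q $ i) * of_real xa"
    by (simp add: sum_lessThan_double target_def sum_distrib_right)
  ultimately show ?thesis unfolding xa_def by simp
qed

section \<open>Source sets of the graph and the left kernel of the Laplacian\<close>

lemma consensus_no_incoming_edges:
  assumes cons: "average_consensus n a b \<epsilon>"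
    and T: "T \<subseteq> {..<n}" "T \<noteq> {}"
    and closed: "\<And>i j. i \<in> T \<Longrightarrow> j < n \<Longrightarrow> j \<notin> T \<Longrightarrow> (j, i) \<notin> E"
  shows "T = {..<n}"
proof -
  \<comment> \<open>Neither state nor surplus can enter \<open>T\<close>, so both stay 0 there
    forever. The consensus value is then 0, which is impossible if some vertex outside
    \<open>T\<close> starts at 1.\<close>
  define x0 :: "real vec" where "x0 = vec n (\<lambda>i. if i \<in> T then 0 else 1)"
  have x0: "x0 \<in> carrier_vec n" by (simp add: x0_def)
  have zero: "\<forall>i\<in>T. traj M n x0 k $ i = 0 \<and> traj M n x0 k $ (n + i) = 0" for k
  proof (induction k)
    case 0
    show ?case using T by (auto simp: x0_def)
  next
    case (Suc k)
    show ?case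
    proof
      fix i assume i: "i \<in> T"
      hence "i < n" using T by auto
      have L0: "L i j * traj M n x0 k $ j = 0" if "j < n" for j
      proof (cases "j \<in> T")
        case False
        hence "a i j = 0" "i \<noteq> j" using a_eq_0[of i j] closed[OF i] that \<open>i < n\<close> i by auto
        thus ?thesis by (simp add: L_def)
      qed (simp add: Suc)
      \<comment> \<open>\<open>P\<close> and \<open>-L\<close> differ only on the diagonal, where
        the state of \<open>i\<close> is 0 by induction.\<close>
      have P0: "P i j * traj M n x0 k $ j = 0" if "j < n" for j
        using L0[OF that] Suc i by (auto simp: P_def left_diff_distrib)
      have S0: "S i j * traj M n x0 k $ (n + j) = 0" if "j < n" for j
      proof (cases "j \<in> T")
        case False
        hence "b j i = 0" "i \<noteq> j" using b_eq_0[of j i] closed[OF i] that \<open>i < n\<close> i by auto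
        thus ?thesis by (simp add: S_def)
      qed (simp add: Suc)
      show "traj M n x0 (Suc k) $ i = 0 \<and> traj M n x0 (Suc k) $ (n + i) = 0"
        using mult_M_index[OF traj_carrier[OF x0, of k] \<open>i < n\<close>] L0 P0 S0 Suc i by simp
    qed
  qed
  obtain i where i: "i \<in> T" "i < n" using T by auto
  have "(\<lambda>k. traj M n x0 k $ i) \<longlonglongrightarrow> (vec n (\<lambda>_. (\<Sum>i<n. x0 $ i) / real n) @\<^sub>v 0\<^sub>v n) $ i"
    using cons[unfolded average_consensus_def Let_def, rule_format, OF x0, of i] i by linarith
  moreover have "(\<lambda>k. traj M n x0 k $ i) = (\<lambda>k. 0)" using zero i by auto
  ultimately have "(\<Sum>i<n. x0 $ i) / real n = 0" using i by (simp add: LIMSEQ_const_iff)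
  hence "(\<Sum>i<n. x0 $ i) = 0" using n by simp
  hence "\<forall>i\<in>{..<n}. x0 $ i = 0"
    by (subst (asm) sum_nonneg_eq_0_iff) (auto simp: x0_def)
  thus ?thesis using T by (force simp: x0_def split: if_splits)
qed

text \<open>Stated over \<open>real_field\<close> to serve both complex kernel vectors and their
  real moduli.\<close>

lemma sum_P_mult:
  fixes w :: "nat \<Rightarrow> 'x :: real_field"
  assumes "j < n"
  shows "(\<Sum>i<n. of_real (P i j) * w i) = w j - (\<Sum>i<n. of_real (L i j) * w i)"
proof -
  have "of_real (P i j) * w i = (if i = j then w i else 0) - of_real (L i j) * w i" for i
    by (simp add: P_def left_diff_distrib)
  thus ?thesis using assms by (simp add: sum_subtractf)
qed

text \<open>A left kernel vector of \<open>L\<close> is fixed by \<open>P\<close> from the left. The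
  triangle inequality bounds each modulus by the corresponding sum; since the rows of
  \<open>P\<close> sum to 1, both sides have the same total over \<open>j\<close>, so every
  inequality is an equality.\<close>

lemma left_kernel_L_norm:
  fixes z :: "nat \<Rightarrow> complex"
  assumes z: "\<And>j. j < n \<Longrightarrow> (\<Sum>i<n. of_real (L i j) * z i) = 0" and j: "j < n"
  shows "(\<Sum>i<n. P i j * cmod (z i)) = cmod (z j)"
    and "(\<Sum>i<n. L i j * cmod (z i)) = 0"
proof -
  have le: "cmod (z j) \<le> (\<Sum>i<n. P i j * cmod (z i))" if "j < n" for j
  proof -
    have "z j = (\<Sum>i<n. of_real (P i j) * z i)" using sum_P_mult[OF that, of z] z[OF that] by simp
    hence "cmod (z j) \<le> (\<Sum>i<n. cmod (of_real (P i j) * z i))" by (metis norm_sum)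
    also have "\<dots> = (\<Sum>i<n. P i j * cmod (z i))"
      using P_nonneg that by (intro sum.cong) (auto simp: norm_mult)
    finally show ?thesis .
  qed
  have "(\<Sum>j<n. \<Sum>i<n. P i j * cmod (z i)) = (\<Sum>i<n. (\<Sum>j<n. P i j) * cmod (z i))"
    by (subst sum.swap) (simp add: sum_distrib_right)
  also have "\<dots> = (\<Sum>i<n. cmod (z i))" by (simp add: P_row_sum)
  finally have "(\<Sum>j<n. (\<Sum>i<n. P i j * cmod (z i)) - cmod (z j)) = 0" by (simp add: sum_subtractf)
  hence "\<forall>j\<in>{..<n}. (\<Sum>i<n. P i j * cmod (z i)) - cmod (z j) = 0"
    by (subst (asm) sum_nonneg_eq_0_iff) (auto simp: le)
  thus eq: "(\<Sum>i<n. P i j * cmod (z i)) = cmod (z j)" using j by auto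
  show "(\<Sum>i<n. L i j * cmod (z i)) = 0"
    using sum_P_mult[OF j, of "\<lambda>i. cmod (z i)"] eq by simp
qed

text \<open>The support of \<open>z\<close> has no incoming edges: if \<open>z j = 0\<close>, the
  moduli identity at \<open>j\<close> is a vanishing sum of nonnegative terms, so
  \<open>P i j = 0\<close> for each \<open>i\<close> in the support.\<close>

lemma left_kernel_L_nonzero:
  fixes z :: "nat \<Rightarrow> complex"
  assumes cons: "average_consensus n a b \<epsilon>"
    and z: "\<And>j. j < n \<Longrightarrow> (\<Sum>i<n. of_real (L i j) * z i) = 0"
    and nz: "k < n" "z k \<noteq> 0" and i: "i < n"
  shows "z i \<noteq> 0"
proof -
  define T where "T = {i. i < n \<and> z i \<noteq> 0}"
  have "T = {..<n}"
  proof (rule consensus_no_incoming_edges[OF cons])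
    show "T \<subseteq> {..<n}" "T \<noteq> {}" using nz by (auto simp: T_def)
    fix i j assume i: "i \<in> T" and j: "j < n" "j \<notin> T"
    have "(\<Sum>i<n. P i j * cmod (z i)) = 0"
      using left_kernel_L_norm(1)[OF z j(1)] j by (simp add: T_def)
    hence "\<forall>i\<in>{..<n}. P i j * cmod (z i) = 0"
      by (subst (asm) sum_nonneg_eq_0_iff) (auto intro!: mult_nonneg_nonneg P_nonneg j)
    hence "P i j = 0" "i \<noteq> j" using i j by (auto simp: T_def)
    hence "a i j = 0" by (simp add: P_def L_def)
    thus "(j, i) \<notin> E" using a_pos[of i j] i j by (auto simp: T_def)
  qed
  thus ?thesis using i by (auto simp: T_def)
qed

lemma left_kernel_L_proportional:
  fixes z w :: "nat \<Rightarrow> complex"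
  assumes cons: "average_consensus n a b \<epsilon>"
    and z: "\<And>j. j < n \<Longrightarrow> (\<Sum>i<n. of_real (L i j) * z i) = 0"
    and w: "\<And>j. j < n \<Longrightarrow> (\<Sum>i<n. of_real (L i j) * w i) = 0"
    and nz: "k < n" "z k \<noteq> 0"
  shows "\<exists>c. \<forall>i<n. w i = c * z i"
proof -
  \<comment> \<open>The kernel element \<open>w - c z\<close> vanishes at \<open>k\<close>, hence everywhere.\<close>
  define c where "c = w k / z k"
  have ker: "(\<Sum>i<n. of_real (L i j) * (w i - c * z i)) = 0" if "j < n" for j
  proof -
    have "(\<Sum>i<n. of_real (L i j) * (w i - c * z i)) =
        (\<Sum>i<n. of_real (L i j) * w i) - c * (\<Sum>i<n. of_real (L i j) * z i)"
      by (simp add: right_diff_distrib sum_subtractf sum_distrib_left mult_ac)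
    thus ?thesis using z w that by simp
  qed
  have "w k - c * z k = 0" using nz by (simp add: c_def)
  hence "w i - c * z i = 0" if "i < n" for i
    using left_kernel_L_nonzero[OF cons ker that _ nz(1)] by blast
  thus ?thesis by auto
qed

subsection \<open>Left eigenvectors under consensus\<close>

lemma Mc_transpose_carrier: "Mc\<^sup>T \<in> carrier_mat (2 * n) (2 * n)"
  using Mc_carrier by (simp only: transpose_carrier_mat)

lemma scalar_prod_state_step:
  assumes x0: "x0 \<in> carrier_vec n" and q: "q \<in> carrier_vec (2 * n)" and p: "p \<in> carrier_vec (2 * n)"
    and Mq: "Mc\<^sup>T *\<^sub>v q = \<mu> \<cdot>\<^sub>v q + \<beta> \<cdot>\<^sub>v p"
  shows "q \<bullet> state x0 (Suc k) = \<mu> * (q \<bullet> state x0 k) + \<beta> * (p \<bullet> state x0 k)"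
  using x0 q p by (simp add: scalar_prod_state_Suc Mq add_scalar_prod_distrib[of _ "2 * n"])

lemma scalar_prod_state_eigenvector:
  assumes x0: "x0 \<in> carrier_vec n" and q: "q \<in> carrier_vec (2 * n)"
    and Mq: "Mc\<^sup>T *\<^sub>v q = \<mu> \<cdot>\<^sub>v q"
  shows "q \<bullet> state x0 k = \<mu> ^ k * (\<Sum>i<n. q $ i * of_real (x0 $ i))"
proof (induction k)
  case 0
  thus ?case using scalar_prod_state_0[OF x0 q] by simp
next
  case (Suc k)
  have "q \<bullet> state x0 (Suc k) = \<mu> * (q \<bullet> state x0 k)"
    using x0 q by (simp add: scalar_prod_state_Suc Mq)
  thus ?case using Suc by simp
qed

lemma sum_mult_unit_vec:
  "i < n \<Longrightarrow> (\<Sum>j<n. f j * of_real (unit_vec n i $ j)) = (f i :: complex)"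
  by (simp add: unit_vec_def if_distrib[of of_real] if_distrib[of "\<lambda>x. _ * x"] cong: if_cong)

text \<open>Here \<open>q\<close> need only behave like an eigenvector on trajectories, so that the lemma also covers
  generalised eigenvectors.\<close>

lemma upper_block_zero:
  assumes cons: "average_consensus n a b \<epsilon>" and q: "q \<in> carrier_vec (2 * n)"
    and step: "\<And>x0 k. x0 \<in> carrier_vec n \<Longrightarrow> q \<bullet> state x0 (Suc k) = \<mu> * (q \<bullet> state x0 k)"
    and \<mu>: "1 \<le> cmod \<mu>" "\<mu> \<noteq> 1" and i: "i < n"
  shows "q $ i = 0"
proof -
  define x0 :: "real vec" where "x0 = unit_vec n i"
  have x0: "x0 \<in> carrier_vec n" by (simp add: x0_def)
  have "q \<bullet> state x0 0 = q $ i"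
    using scalar_prod_state_0[OF x0 q] sum_mult_unit_vec[OF i] by (simp add: x0_def)
  hence "q \<bullet> state x0 k = \<mu> ^ k * q $ i" for k
    by (induction k) (simp_all add: step[OF x0])
  thus ?thesis
    using scalar_prod_state_tendsto[OF cons x0 q] power_mult_convergent_imp[OF _ \<mu>] by simp
qed

text \<open>Convergence of the pairings kills the upper half of \<open>p\<close>. The two block rows
  of the eigenvalue equation then decouple into a kernel condition for \<open>L\<close> and an
  eigenvalue equation for \<open>S\<close>.\<close>

lemma left_eigenvector_large:
  assumes cons: "average_consensus n a b \<epsilon>" and p: "p \<in> carrier_vec (2 * n)"
    and Mp: "Mc\<^sup>T *\<^sub>v p = \<nu> \<cdot>\<^sub>v p" and \<nu>: "1 \<le> cmod \<nu>" "\<nu> \<noteq> 1"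
  shows "i < n \<Longrightarrow> p $ i = 0"
    and "j < n \<Longrightarrow> (\<Sum>i<n. of_real (L i j) * p $ (n + i)) = 0"
    and "j < n \<Longrightarrow> (\<Sum>i<n. of_real (S i j) * p $ (n + i)) = (\<nu> + of_real \<epsilon>) * p $ (n + j)"
    and "x0 \<in> carrier_vec n \<Longrightarrow> p \<bullet> state x0 k = 0"
proof -
  show zero: "p $ i = 0" if "i < n" for i
    by (rule upper_block_zero[OF cons p _ \<nu> that])
      (simp add: scalar_prod_state_eigenvector[OF _ p Mp])
  show "x0 \<in> carrier_vec n \<Longrightarrow> p \<bullet> state x0 k = 0"
    by (simp add: scalar_prod_state_eigenvector[OF _ p Mp] zero)
  have comp: "(Mc\<^sup>T *\<^sub>v p) $ k = \<nu> * p $ k" if "k < 2 * n" for k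
    unfolding Mp using p that by simp
  show "(\<Sum>i<n. of_real (L i j) * p $ (n + i)) = 0" if "j < n"
  proof -
    have "(\<Sum>i<n. of_real (P i j) * p $ i) + (\<Sum>i<n. of_real (L i j) * p $ (n + i)) = \<nu> * p $ j"
      unfolding mult_Mc_transpose_index(1)[OF p that, symmetric] using that by (intro comp) simp
    thus ?thesis using that by (simp add: zero)
  qed
  show "(\<Sum>i<n. of_real (S i j) * p $ (n + i)) = (\<nu> + of_real \<epsilon>) * p $ (n + j)" if "j < n"
  proof -
    have "of_real \<epsilon> * p $ j + (\<Sum>i<n. of_real (S i j) * p $ (n + i)) - of_real \<epsilon> * p $ (n + j)
        = \<nu> * p $ (n + j)"
      unfolding mult_Mc_transpose_index(2)[OF p that, symmetric] using that by (intro comp) simp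
    thus ?thesis using that by (simp add: zero algebra_simps)
  qed
qed

lemma lower_block_nonzero:
  assumes "p \<in> carrier_vec (2 * n)" "p \<noteq> 0\<^sub>v (2 * n)" "\<And>i. i < n \<Longrightarrow> p $ i = 0"
  obtains k where "k < n" "p $ (n + k) \<noteq> 0"
proof -
  obtain i where i: "i < 2 * n" "p $ i \<noteq> 0" using assms(1,2)
    by (metis carrier_vecD eq_vecI index_zero_vec)
  from i(1) show ?thesis
    by (cases rule: less_double_cases) (use i assms(3) that in auto)
qed

text \<open>Both vectors of the Schur pair would have zero upper half and a lower half in the left
  kernel of \<open>L\<close>, which is at most one-dimensional. The case
  \<open>\<nu> = \<mu>\<close> is included and yields simplicity.\<close>

lemma not_two_large_roots:
  assumes cons: "average_consensus n a b \<epsilon>"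
    and cp: "char_poly Mc = (\<Prod>e \<leftarrow> \<nu> # \<mu> # es. [:- e, 1:])"
    and \<nu>: "1 \<le> cmod \<nu>" "\<nu> \<noteq> 1" and \<mu>: "1 \<le> cmod \<mu>" "\<mu> \<noteq> 1"
  shows False
proof -
  have "char_poly Mc\<^sup>T = (\<Prod>e \<leftarrow> \<nu> # \<mu> # es. [:- e, 1:])"
    using cp char_poly_transpose_mat[OF Mc_carrier] by simp
  then obtain p q \<beta> where p: "p \<in> carrier_vec (2 * n)" "p \<noteq> 0\<^sub>v (2 * n)" and q: "q \<in> carrier_vec (2 * n)"
    and Mp: "Mc\<^sup>T *\<^sub>v p = \<nu> \<cdot>\<^sub>v p" and Mq: "Mc\<^sup>T *\<^sub>v q = \<mu> \<cdot>\<^sub>v q + \<beta> \<cdot>\<^sub>v p"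
    and indep: "\<And>c. q \<noteq> c \<cdot>\<^sub>v p"
    by (rule char_poly_two_roots_vectors[OF Mc_transpose_carrier]) blast
  note P = left_eigenvector_large[OF cons p(1) Mp \<nu>]
  \<comment> \<open>The term with \<open>\<beta>\<close> disappears on trajectories, because
    \<open>p\<close> pairs to 0 with every state.\<close>
  have q0: "q $ i = 0" if "i < n" for i
    by (rule upper_block_zero[OF cons q _ \<mu> that])
      (simp add: scalar_prod_state_step[OF _ q p(1) Mq] P(4))
  have Lq: "(\<Sum>i<n. of_real (L i j) * q $ (n + i)) = 0" if j: "j < n" for j
  proof -
    have "(Mc\<^sup>T *\<^sub>v q) $ j = 0" unfolding Mq using q p j by (simp add: q0 P(1))
    thus ?thesis using mult_Mc_transpose_index(1)[OF q j] by (simp add: q0)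
  qed
  obtain k where k: "k < n" "p $ (n + k) \<noteq> 0"
    using lower_block_nonzero[OF p P(1)] by blast
  obtain c where c: "\<And>i. i < n \<Longrightarrow> q $ (n + i) = c * p $ (n + i)"
    using left_kernel_L_proportional[OF cons P(2) Lq k] by blast
  have "q = c \<cdot>\<^sub>v p"
  proof (rule eq_vecI)
    fix i assume "i < dim_vec (c \<cdot>\<^sub>v p)"
    hence i: "i < 2 * n" using p by simp
    thus "q $ i = (c \<cdot>\<^sub>v p) $ i"
      by (cases rule: less_double_cases) (use i p q0 P(1) c in auto)
  qed (use p q in auto)
  thus False using indep by blast
qed

text \<open>At an entry of largest modulus the equation bounds \<open>cmod \<tau> * m\<close> by an
  average of moduli with weights from one column of \<open>S\<close>, hence by
  \<open>m\<close>.\<close>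

lemma S_left_eigenvalue_bound:
  fixes u :: "nat \<Rightarrow> complex"
  assumes u: "\<And>j. j < n \<Longrightarrow> (\<Sum>i<n. of_real (S i j) * u i) = \<tau> * u j"
    and nz: "k < n" "u k \<noteq> 0"
  shows "cmod \<tau> \<le> 1"
proof -
  define m where "m = Max ((\<lambda>i. cmod (u i)) ` {..<n})"
  have le: "cmod (u i) \<le> m" if "i < n" for i unfolding m_def using that by (intro Max_ge) auto
  have "m \<in> (\<lambda>i. cmod (u i)) ` {..<n}" unfolding m_def using nz by (intro Max_in) auto
  then obtain j where j: "j < n" "m = cmod (u j)" by auto
  have m: "0 < m" using le[OF nz(1)] nz by (meson less_le_trans zero_less_norm_iff)
  have "cmod \<tau> * m \<le> (\<Sum>i<n. cmod (of_real (S i j) * u i))"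
    unfolding j(2) norm_mult[symmetric] u[OF j(1), symmetric] by (rule norm_sum)
  also have "\<dots> = (\<Sum>i<n. S i j * cmod (u i))"
    using S_nonneg j by (intro sum.cong) (auto simp: norm_mult)
  also have "\<dots> \<le> (\<Sum>i<n. S i j * m)"
    using le S_nonneg j by (intro sum_mono mult_left_mono) auto
  also have "\<dots> = m" using S_col_sum[OF j(1)] by (simp flip: sum_distrib_right)
  finally show ?thesis using m by simp
qed

text \<open>The pairing with \<open>p\<close> is conserved, so starting from the unit vector at
  \<open>i\<close> its value \<open>p $ i\<close> equals its limit, the mean \<open>c\<close> of the
  upper entries.\<close>

lemma left_eigenvector_one_const:
  assumes cons: "average_consensus n a b \<epsilon>" and p: "p \<in> carrier_vec (2 * n)"
    and Mp: "Mc\<^sup>T *\<^sub>v p = p"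
  shows "\<exists>c. p = vec (2 * n) (\<lambda>_. c)"
proof -
  define c where "c = (\<Sum>i<n. p $ i) / of_nat n"
  have Mp1: "Mc\<^sup>T *\<^sub>v p = 1 \<cdot>\<^sub>v p" using Mp by simp
  have up: "p $ i = c" if i: "i < n" for i
  proof -
    define x0 :: "real vec" where "x0 = unit_vec n i"
    have x0: "x0 \<in> carrier_vec n" by (simp add: x0_def)
    have "p \<bullet> state x0 k = p $ i" for k
      using scalar_prod_state_eigenvector[OF x0 p Mp1] sum_mult_unit_vec[OF i] by (simp add: x0_def)
    hence "p $ i = (\<Sum>i<n. p $ i) * of_real ((\<Sum>i<n. x0 $ i) / real n)"
      using scalar_prod_state_tendsto[OF cons x0 p] by (simp add: LIMSEQ_const_iff)
    moreover have "(\<Sum>j<n. x0 $ j) = 1" using i by (simp add: x0_def unit_vec_def)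
    ultimately show ?thesis by (simp add: c_def)
  qed
  \<comment> \<open>Since the columns of \<open>S\<close> sum to 1, subtracting \<open>c\<close>
    makes the lower block equation homogeneous with eigenvalue \<open>1 + \<epsilon>\<close>, beyond
    the bound 1 for \<open>S\<close>.\<close>
  define u where "u i = p $ (n + i) - c" for i
  have S1: "(\<Sum>i<n. complex_of_real (S i j)) = 1" if "j < n" for j
    using S_col_sum[OF that] by (metis of_real_1 of_real_sum)
  have "(\<Sum>i<n. of_real (S i j) * u i) = of_real (1 + \<epsilon>) * u j" if j: "j < n" for j
  proof -
    have "p $ (n + j) = of_real \<epsilon> * p $ j + (\<Sum>i<n. of_real (S i j) * p $ (n + i)) - of_real \<epsilon> * p $ (n + j)"
      using mult_Mc_transpose_index(2)[OF p j] Mp by simp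
    moreover have "(\<Sum>i<n. of_real (S i j) * u i) = (\<Sum>i<n. of_real (S i j) * p $ (n + i)) - c"
      using S1[OF j] by (simp add: u_def right_diff_distrib sum_subtractf flip: sum_distrib_right)
    ultimately show ?thesis by (simp add: u_def up[OF j] algebra_simps)
  qed
  moreover have "\<not> cmod (of_real (1 + \<epsilon>)) \<le> 1" using eps by (simp only: norm_of_real)
  ultimately have low: "u i = 0" if "i < n" for i using S_left_eigenvalue_bound that by blast
  have "p = vec (2 * n) (\<lambda>_. c)"
  proof (rule eq_vecI)
    fix i assume "i < dim_vec (vec (2 * n) (\<lambda>_. c))"
    hence i: "i < 2 * n" by simp
    thus "p $ i = vec (2 * n) (\<lambda>_. c) $ i"
      by (cases rule: less_double_cases) (use i up low in \<open>auto simp: u_def\<close>)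
  qed (use p in auto)
  thus ?thesis by blast
qed

text \<open>A Jordan-type pair would make the pairing with \<open>q\<close> grow by the fixed amount
  \<open>\<beta> * c\<close> at every step. Convergence forces \<open>\<beta> = 0\<close>, and then
  both vectors are constant, hence proportional.\<close>

lemma not_two_unit_roots:
  assumes cons: "average_consensus n a b \<epsilon>"
    and cp: "char_poly Mc = (\<Prod>e \<leftarrow> 1 # 1 # es. [:- e, 1:])"
  shows False
proof -
  have "char_poly Mc\<^sup>T = (\<Prod>e \<leftarrow> 1 # 1 # es. [:- e, 1:])"
    using cp char_poly_transpose_mat[OF Mc_carrier] by simp
  then obtain p q \<beta> where p: "p \<in> carrier_vec (2 * n)" "p \<noteq> 0\<^sub>v (2 * n)" and q: "q \<in> carrier_vec (2 * n)"
    and Mp: "Mc\<^sup>T *\<^sub>v p = 1 \<cdot>\<^sub>v p" and Mq: "Mc\<^sup>T *\<^sub>v q = 1 \<cdot>\<^sub>v q + \<beta> \<cdot>\<^sub>v p"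
    and indep: "\<And>c. q \<noteq> c \<cdot>\<^sub>v p"
    by (rule char_poly_two_roots_vectors[OF Mc_transpose_carrier]) blast
  obtain c where c: "p = vec (2 * n) (\<lambda>_. c)"
    using left_eigenvector_one_const[OF cons p(1)] Mp by auto
  have c0: "c \<noteq> 0" using p(2) unfolding c by (auto simp: zero_vec_def)
  define x0 :: "real vec" where "x0 = unit_vec n 0"
  have x0: "x0 \<in> carrier_vec n" by (simp add: x0_def)
  have pc: "p \<bullet> state x0 k = c" for k
    using scalar_prod_state_eigenvector[OF x0 p(1) Mp] sum_mult_unit_vec[of 0] n
    by (simp add: x0_def c)
  have step: "q \<bullet> state x0 (Suc k) - q \<bullet> state x0 k = \<beta> * c" for k
    using scalar_prod_state_step[OF x0 q p(1) Mq] pc by simp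
  have "(\<lambda>k. q \<bullet> state x0 (Suc k) - q \<bullet> state x0 k) \<longlonglongrightarrow> 0"
    using tendsto_diff[OF LIMSEQ_Suc[OF scalar_prod_state_tendsto[OF cons x0 q]]
      scalar_prod_state_tendsto[OF cons x0 q]] by simp
  hence "\<beta> * c = 0" unfolding step by (simp add: LIMSEQ_const_iff)
  hence "\<beta> = 0" using c0 by simp
  hence "Mc\<^sup>T *\<^sub>v q = q" unfolding Mq using p q by (intro eq_vecI) auto
  then obtain d where d: "q = vec (2 * n) (\<lambda>_. d)"
    using left_eigenvector_one_const[OF cons q] by auto
  have "q = (d / c) \<cdot>\<^sub>v p" unfolding c d using c0 by (intro eq_vecI) auto
  thus False using indep by blast
qed

section \<open>The right eigenvector for the eigenvalue 1\<close>

definition consensus_vec :: "complex vec" where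
  "consensus_vec = vec (2 * n) (\<lambda>i. if i < n then 1 else 0)"

lemma consensus_vec_carrier [simp]: "consensus_vec \<in> carrier_vec (2 * n)"
  by (simp add: consensus_vec_def)

lemma Mc_consensus_vec: "Mc *\<^sub>v consensus_vec = consensus_vec"
proof (rule eq_vecI)
  fix i assume "i < dim_vec consensus_vec"
  hence i: "i < 2 * n" by (simp add: consensus_vec_def)
  have "(Mc *\<^sub>v consensus_vec) $ i = (\<Sum>j<2 * n. of_real (M $$ (i,j)) * consensus_vec $ j)"
    using i by (simp add: scalar_prod_def atLeast0LessThan consensus_vec_def)
  also have "\<dots> = of_real (\<Sum>j<n. M $$ (i,j))"
    by (simp add: sum_lessThan_double consensus_vec_def)
  also have "\<dots> = consensus_vec $ i"
    using i by (cases rule: less_double_cases)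
      (simp_all add: M_entries P_row_sum L_row_sum consensus_vec_def)
  finally show "(Mc *\<^sub>v consensus_vec) $ i = consensus_vec $ i" .
qed (simp add: consensus_vec_def)

lemma consensus_vec_nonzero: "consensus_vec \<noteq> 0\<^sub>v (2 * n)"
proof
  assume "consensus_vec = 0\<^sub>v (2 * n)"
  hence "consensus_vec $ 0 = 0\<^sub>v (2 * n) $ 0" by simp
  thus False using n by (simp add: consensus_vec_def)
qed

lemma eigenvalue_Mc_one: "eigenvalue Mc 1"
  unfolding eigenvalue_def eigenvector_def
  by (rule exI[of _ consensus_vec]) (simp add: Mc_consensus_vec consensus_vec_nonzero)

subsection \<open>Excluding eigenvalues invisible to the trajectories\<close>

lemma det_M: "det M = det ((1\<^sub>m n - lap_mat n a) * S_mat n b - \<epsilon> \<cdot>\<^sub>m 1\<^sub>m n)"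
proof -
  let ?I = "1\<^sub>m n :: real mat" and ?L = "lap_mat n a" and ?S = "S_mat n b"
  \<comment> \<open>Adding the first block row to the second turns the lower left block into the identity.\<close>
  let ?R = "four_block_mat ?I (0\<^sub>m n n) ?I ?I"
  have LS: "?L \<in> carrier_mat n n" "?S \<in> carrier_mat n n" by (simp_all add: lap_mat_def S_mat_def)
  have "det ?R = det ?I * det ?I" by (rule det_four_block_mat_upper_right_zero) auto
  hence R: "det ?R = 1" by simp
  have Rc: "?R \<in> carrier_mat (2 * n) (2 * n)" unfolding mult_2 by (rule four_block_carrier_mat) auto
  have "?R * M = four_block_mat (?I * (?I - ?L) + 0\<^sub>m n n * ?L) (?I * (\<epsilon> \<cdot>\<^sub>m ?I) + 0\<^sub>m n n * (?S - \<epsilon> \<cdot>\<^sub>m ?I))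
      (?I * (?I - ?L) + ?I * ?L) (?I * (\<epsilon> \<cdot>\<^sub>m ?I) + ?I * (?S - \<epsilon> \<cdot>\<^sub>m ?I))"
    unfolding M_mat_def by (rule mult_four_block_mat) (use LS in auto)
  also have "?I * (?I - ?L) + 0\<^sub>m n n * ?L = ?I - ?L" using LS by (intro eq_matI) auto
  also have "?I * (\<epsilon> \<cdot>\<^sub>m ?I) + 0\<^sub>m n n * (?S - \<epsilon> \<cdot>\<^sub>m ?I) = \<epsilon> \<cdot>\<^sub>m ?I" using LS by (intro eq_matI) auto
  also have "?I * (?I - ?L) + ?I * ?L = ?I" using LS by (intro eq_matI) auto
  also have "?I * (\<epsilon> \<cdot>\<^sub>m ?I) + ?I * (?S - \<epsilon> \<cdot>\<^sub>m ?I) = ?S" using LS by (intro eq_matI) auto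
  finally have RM: "?R * M = four_block_mat (?I - ?L) (\<epsilon> \<cdot>\<^sub>m ?I) ?I ?S" .
  have "det M = det (?R * M)" using det_mult[OF Rc M_carrier] R by simp
  \<comment> \<open>The block formula det(AD - BC) applies because the lower blocks, now the
    identity and \<open>S_mat n b\<close>, commute.\<close>
  also have "\<dots> = det ((?I - ?L) * ?S - \<epsilon> \<cdot>\<^sub>m ?I * ?I)"
    unfolding RM by (rule det_four_block_mat) (use LS in auto)
  also have "\<epsilon> \<cdot>\<^sub>m ?I * ?I = \<epsilon> \<cdot>\<^sub>m ?I" using right_mult_one_mat[of "\<epsilon> \<cdot>\<^sub>m ?I" n n] by simp
  finally show ?thesis .
qed

text \<open>Left multiplication by \<open>P\<close> fixes \<open>z\<close> and by \<open>S\<close>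
  scales it by \<open>\<sigma>\<close>, so \<open>z\<close> is a left eigenvector of their product
  \<open>N\<close>. All eigenvalues of \<open>N\<close> then lie within \<open>\<sigma>\<close> of
  0, and those of \<open>K\<close> stay at distance at least \<open>\<epsilon> - \<sigma>\<close>
  from 0.\<close>

lemma norm_det_M_ge:
  assumes z: "\<And>i. i < n \<Longrightarrow> 0 < z i"
    and zL: "\<And>j. j < n \<Longrightarrow> (\<Sum>i<n. L i j * z i) = 0"
    and zS: "\<And>j. j < n \<Longrightarrow> (\<Sum>i<n. S i j * z i) = \<sigma> * z j"
    and \<sigma>: "\<sigma> \<le> \<epsilon>"
  shows "(\<epsilon> - \<sigma>) ^ n \<le> cmod (det Mc)"
proof -
  define N where "N = (1\<^sub>m n - lap_mat n a) * S_mat n b"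
  define K where "K = N - \<epsilon> \<cdot>\<^sub>m 1\<^sub>m n"
  have N: "N \<in> carrier_mat n n"
    unfolding N_def by (rule mult_carrier_mat[of _ n n]) (auto simp: lap_mat_def S_mat_def)
  have K: "K \<in> carrier_mat n n" by (simp add: K_def minus_carrier_mat)
  have Nij: "N $$ (i,j) = (\<Sum>k<n. P i k * S k j)" if "i < n" "j < n" for i j
    using that by (simp add: N_def scalar_prod_def lap_mat_def S_mat_def P_def L_def S_def atLeast0LessThan)
  have nonneg: "0 \<le> N $$ (i,j)" if "i < n" "j < n" for i j
    unfolding Nij[OF that] using that by (intro sum_nonneg mult_nonneg_nonneg P_nonneg S_nonneg) auto
  have zP: "(\<Sum>i<n. P i j * z i) = z j" if "j < n" for j
    using sum_P_mult[OF that, of z] zL[OF that] by simp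
  have zN: "(\<Sum>i<n. z i * N $$ (i,j)) = \<sigma> * z j" if j: "j < n" for j
  proof -
    have "(\<Sum>i<n. z i * N $$ (i,j)) = (\<Sum>i<n. \<Sum>k<n. z i * (P i k * S k j))"
      using j by (simp add: Nij sum_distrib_left)
    also have "\<dots> = (\<Sum>k<n. S k j * (\<Sum>i<n. P i k * z i))"
      by (subst sum.swap) (simp add: sum_distrib_left mult_ac)
    also have "\<dots> = \<sigma> * z j" using zS[OF j] by (simp add: zP)
    finally show ?thesis .
  qed
  have Kc: "map_mat complex_of_real K \<in> carrier_mat n n" using K by simp
  have "\<epsilon> - \<sigma> \<le> cmod \<eta>" if ev: "eigenvalue (map_mat complex_of_real K) \<eta>" for \<eta>
  proof -
    obtain x where x: "x \<in> carrier_vec n" "x \<noteq> 0\<^sub>v n" "map_mat complex_of_real K *\<^sub>v x = \<eta> \<cdot>\<^sub>v x"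
      using ev K by (auto simp: eigenvalue_def eigenvector_def)
    have "map_mat complex_of_real N = map_mat complex_of_real K + of_real \<epsilon> \<cdot>\<^sub>m 1\<^sub>m n"
      using N by (intro eq_matI) (auto simp: K_def)
    hence "map_mat complex_of_real N *\<^sub>v x = \<eta> \<cdot>\<^sub>v x + of_real \<epsilon> \<cdot>\<^sub>v x"
      using add_mult_distrib_mat_vec[OF Kc, of "of_real \<epsilon> \<cdot>\<^sub>m 1\<^sub>m n" x] x
        mult_smult_mat_vec[of "1\<^sub>m n" n n x "of_real \<epsilon>"] by simp
    also have "\<dots> = (\<eta> + of_real \<epsilon>) \<cdot>\<^sub>v x" by (simp add: add_smult_distrib_vec)
    finally have evN: "eigenvalue (map_mat complex_of_real N) (\<eta> + of_real \<epsilon>)"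
      using x N unfolding eigenvalue_def eigenvector_def by auto
    have "cmod (\<eta> + of_real \<epsilon>) \<le> \<sigma>"
      by (rule nonneg_mat_eigenvalue_bound[OF N nonneg z zN]) (use evN in auto)
    moreover have "cmod (of_real \<epsilon>) \<le> cmod (\<eta> + of_real \<epsilon>) + cmod \<eta>"
      using norm_triangle_ineq4[of "\<eta> + of_real \<epsilon>" \<eta>] by simp
    ultimately show ?thesis using eps by simp
  qed
  hence "(\<epsilon> - \<sigma>) ^ n \<le> cmod (det (map_mat complex_of_real K))"
    using \<sigma> by (intro norm_det_ge_power[OF Kc]) auto
  moreover have "det M = det K" unfolding K_def N_def by (rule det_M)
  ultimately show ?thesis by simp
qed

lemma norm_prod_list_less_one:
  fixes es :: "complex list"
  assumes "es \<noteq> []" "\<And>e. e \<in> set es \<Longrightarrow> cmod e < 1"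
  shows "cmod (prod_list es) < 1"
  using assms
proof (induction es rule: list_nonempty_induct)
  case (cons e es)
  have "cmod (prod_list es) < 1" using cons by simp
  hence "cmod e * cmod (prod_list es) \<le> cmod e * 1" by (intro mult_left_mono) auto
  moreover have "cmod e < 1" using cons.prems by simp
  ultimately show ?case by (simp add: norm_mult)
qed simp

lemma no_large_root:
  assumes cons: "average_consensus n a b \<epsilon>"
    and cp: "char_poly Mc = (\<Prod>e \<leftarrow> 1 # \<nu> # es. [:- e, 1:])" and len: "length es = 2 * n - 2"
    and \<nu>: "1 \<le> cmod \<nu>" "\<nu> \<noteq> 1"
  shows False
proof -
  have "poly (char_poly Mc\<^sup>T) \<nu> = 0"
    unfolding char_poly_transpose_mat[OF Mc_carrier] cp by simp
  hence "eigenvalue Mc\<^sup>T \<nu>" by (simp only: eigenvalue_root_char_poly[OF Mc_transpose_carrier])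
  then obtain p where p: "p \<in> carrier_vec (2 * n)" "p \<noteq> 0\<^sub>v (2 * n)" and Mp: "Mc\<^sup>T *\<^sub>v p = \<nu> \<cdot>\<^sub>v p"
    by (auto simp: eigenvalue_def eigenvector_def)
  note ev = left_eigenvector_large[OF cons p(1) Mp \<nu>]
  obtain k where k: "k < n" "p $ (n + k) \<noteq> 0"
    using lower_block_nonzero[OF p ev(1)] by blast
  \<comment> \<open>The moduli again form a left kernel vector of \<open>L\<close>, now positive.
    The lower half of \<open>p\<close> is a multiple of it, so the eigenvalue equation for
    \<open>S\<close> passes to a real positive vector.\<close>
  define z where "z i = cmod (p $ (n + i))" for i
  have zpos: "0 < z i" if "i < n" for i
    unfolding z_def using left_kernel_L_nonzero[OF cons ev(2) k that] by simp
  have zL: "(\<Sum>i<n. L i j * z i) = 0" if "j < n" for j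
    unfolding z_def using left_kernel_L_norm(2)[OF ev(2) that] .
  have zLc: "(\<Sum>i<n. of_real (L i j) * complex_of_real (z i)) = 0" if "j < n" for j
    using zL[OF that] by (metis (no_types, lifting) of_real_0 of_real_mult of_real_sum sum.cong)
  obtain c where c: "\<And>i. i < n \<Longrightarrow> p $ (n + i) = c * of_real (z i)"
    using left_kernel_L_proportional[OF cons zLc ev(2), of k] k(1) zpos[OF k(1)] by auto
  have c0: "c \<noteq> 0" using c[OF k(1)] k by auto
  have zSc: "complex_of_real (\<Sum>i<n. S i j * z i) = (\<nu> + of_real \<epsilon>) * of_real (z j)" if j: "j < n" for j
  proof -
    have "c * complex_of_real (\<Sum>i<n. S i j * z i) = (\<Sum>i<n. of_real (S i j) * p $ (n + i))"
      by (simp add: c sum_distrib_left mult_ac)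
    also have "\<dots> = c * ((\<nu> + of_real \<epsilon>) * of_real (z j))" using ev(3)[OF j] by (simp add: c[OF j])
    finally show ?thesis using c0 by simp
  qed
  define \<sigma> where "\<sigma> = (\<Sum>i<n. S i k * z i) / z k"
  have \<nu>\<sigma>: "\<nu> + of_real \<epsilon> = of_real \<sigma>" using zSc[OF k(1)] zpos[OF k(1)] by (simp add: \<sigma>_def)
  have zS: "(\<Sum>i<n. S i j * z i) = \<sigma> * z j" if "j < n" for j
    using zSc[OF that] unfolding \<nu>\<sigma> by (metis of_real_eq_iff of_real_mult)
  have "cmod (of_real \<sigma>) \<le> 1"
    using S_left_eigenvalue_bound[of "\<lambda>i. of_real (z i)" "of_real \<sigma>" k] zSc zpos[OF k(1)] k(1)
    by (simp add: \<nu>\<sigma>)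
  hence \<sigma>1: "\<sigma> \<le> 1" by simp
  have \<nu>_eq: "\<nu> = of_real (\<sigma> - \<epsilon>)" using \<nu>\<sigma> by (simp add: algebra_simps)
  hence "cmod \<nu> = \<bar>\<sigma> - \<epsilon>\<bar>" by (simp only: norm_of_real)
  \<comment> \<open>As \<open>\<sigma> \<le> 1\<close> and \<open>\<epsilon> > 0\<close>, the real
    number \<open>\<nu>\<close> is below 1; having modulus at least 1, it is at most -1.\<close>
  hence \<nu>n: "cmod \<nu> = \<epsilon> - \<sigma>" "1 \<le> \<epsilon> - \<sigma>" using \<sigma>1 eps \<nu> by linarith+
  have "cmod \<nu> \<le> (\<epsilon> - \<sigma>) ^ n"
    using \<nu>n power_increasing[of 1 n "\<epsilon> - \<sigma>"] n by simp
  also have "\<dots> \<le> cmod (det Mc)"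
    by (rule norm_det_M_ge[OF zpos zL zS]) (use \<nu>n in auto)
  also have "det Mc = prod_list (1 # \<nu> # es)" by (rule det_eq_prod_list_roots[OF Mc_carrier cp])
  finally have ge: "cmod \<nu> \<le> cmod \<nu> * cmod (prod_list es)" by (simp add: norm_mult)
  \<comment> \<open>A further root outside the open disc would be either a second 1 or a second
    large root different from 1; both are excluded.\<close>
  have "cmod e < 1" if e: "e \<in> set es" for e
  proof (rule ccontr)
    assume "\<not> cmod e < 1"
    hence e1: "1 \<le> cmod e" by simp
    obtain rest where rest: "mset es = mset (e # rest)"
      using e by (metis ex_mset insert_DiffM mset.simps(2) set_mset_mset)
    show False
    proof (cases "e = 1")
      case True
      have "mset (1 # \<nu> # es) = mset (1 # 1 # \<nu> # rest)" using rest True by simp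
      from prod_list_linear_reorder[OF this] cp show False
        using not_two_unit_roots[OF cons] by metis
    next
      case False
      have "mset (1 # \<nu> # es) = mset (\<nu> # e # 1 # rest)" using rest by simp
      from prod_list_linear_reorder[OF this] cp show False
        using not_two_large_roots[OF cons _ \<nu> e1 False] by metis
    qed
  qed
  \<comment> \<open>The strict bound needs a remaining root, since an empty product would be 1;
    there are \<open>2 * n - 2 > 0\<close> of them.\<close>
  moreover have "es \<noteq> []" using len n by auto
  ultimately have "cmod (prod_list es) < 1" using norm_prod_list_less_one by blast
  hence "cmod \<nu> * cmod (prod_list es) < cmod \<nu> * 1" using \<nu> by (intro mult_strict_left_mono) auto
  thus False using ge by simp
qed

section \<open>From consensus to the spectral condition\<close>

lemma consensus_imp_spectrum:
  assumes cons: "average_consensus n a b \<epsilon>"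
  shows "order 1 (char_poly Mc) = 1" and "eigenvalue Mc z \<Longrightarrow> z \<noteq> 1 \<Longrightarrow> cmod z < 1"
proof -
  obtain as where cpa: "char_poly Mc = (\<Prod>e \<leftarrow> as. [:- e, 1:])" and len: "length as = 2 * n"
    using char_poly_factorized[OF Mc_carrier] by blast
  have root: "e \<in> set as" if "eigenvalue Mc e" for e
    using that unfolding eigenvalue_root_char_poly[OF Mc_carrier] cpa
    by (auto simp: poly_prod_list_zero_iff)
  obtain rest where rest: "mset as = mset (1 # rest)"
    using root[OF eigenvalue_Mc_one] by (metis ex_mset insert_DiffM mset.simps(2) set_mset_mset)
  have cp: "char_poly Mc = (\<Prod>e \<leftarrow> 1 # rest. [:- e, 1:])"
    unfolding cpa by (rule prod_list_linear_reorder[OF rest])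
  \<comment> \<open>Brings a suspect root directly behind the root 1, the position in which the
    exclusion lemmas expect it.\<close>
  have split: "\<exists>es. mset (1 # rest) = mset (1 # e # es) \<and> length es = 2 * n - 2" if e: "e \<in> set rest" for e
  proof -
    obtain es where es: "mset rest = mset (e # es)"
      using e by (metis ex_mset insert_DiffM mset.simps(2) set_mset_mset)
    have "length as = length (1 # e # es)"
      using rest es by (metis mset.simps(2) mset_eq_length)
    thus ?thesis using es len by (intro exI[of _ es]) simp
  qed
  have "1 \<notin> set rest"
  proof
    assume "1 \<in> set rest"
    then obtain es where "mset (1 # rest) = mset (1 # 1 # es)" using split by blast
    from prod_list_linear_reorder[OF this] cp show False
      using not_two_unit_roots[OF cons] by metis
  qed
  thus "order 1 (char_poly Mc) = 1"
    unfolding cp order_prod_linear by (simp add: count_eq_zero_iff)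
  show "cmod z < 1" if z: "eigenvalue Mc z" "z \<noteq> 1"
  proof (rule ccontr)
    assume "\<not> cmod z < 1"
    hence z1: "1 \<le> cmod z" by simp
    have "z \<in># mset as" using root[OF z(1)] by simp
    hence "z \<in> set rest" unfolding rest using z(2) by simp
    then obtain es where es: "mset (1 # rest) = mset (1 # z # es)" "length es = 2 * n - 2"
      using split by blast
    from prod_list_linear_reorder[OF es(1)] cp show False
      using no_large_root[OF cons _ es(2) z1 z(2)] by metis
  qed
qed

section \<open>From the spectral condition to consensus\<close>

lemma spectrum_imp_consensus:
  assumes ord: "order 1 (char_poly Mc) = 1"
    and small: "\<And>z. eigenvalue Mc z \<Longrightarrow> z \<noteq> 1 \<Longrightarrow> cmod z < 1"
  shows "average_consensus n a b \<epsilon>"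
proof -
  define v where "v = consensus_vec"
  have v: "v \<in> carrier_vec (2 * n)" "v \<noteq> 0\<^sub>v (2 * n)" "Mc *\<^sub>v v = v"
    by (simp_all only: v_def consensus_vec_carrier consensus_vec_nonzero Mc_consensus_vec not_False_eq_True)
  define total where "total u = (\<Sum>i<2 * n. u $ i)" for u :: "complex vec"
  have total_v: "total v = of_nat n"
    by (simp add: total_def sum_lessThan_double v_def consensus_vec_def)
  have total_smult: "total (c \<cdot>\<^sub>v u) = c * total u" if "u \<in> carrier_vec (2 * n)" for c u
    using that by (simp add: total_def sum_distrib_left)
  have total_Mc: "total (Mc *\<^sub>v u) = total u" if u: "u \<in> carrier_vec (2 * n)" for u
  proof -
    have "total (Mc *\<^sub>v u) = (\<Sum>i<2 * n. \<Sum>j<2 * n. of_real (M $$ (i,j)) * u $ j)"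
      using u by (simp add: total_def scalar_prod_def atLeast0LessThan)
    also have "\<dots> = (\<Sum>j<2 * n. complex_of_real (\<Sum>i<2 * n. M $$ (i,j)) * u $ j)"
      by (subst sum.swap) (simp add: sum_distrib_right)
    also have "\<dots> = total u" by (simp only: total_def) (intro sum.cong; simp add: M_col_sum)
    finally show ?thesis .
  qed
  \<comment> \<open>Deflation: \<open>A\<close> kills \<open>v\<close> and acts like \<open>M\<close> on the vectors of total 0.\<close>
  define A where "A = mat (2 * n) (2 * n) (\<lambda>(i,j). Mc $$ (i,j) - v $ i / of_nat n)"
  have A: "A \<in> carrier_mat (2 * n) (2 * n)" by (simp add: A_def)
  have A_mult: "A *\<^sub>v u = Mc *\<^sub>v u - (total u / of_nat n) \<cdot>\<^sub>v v" if u: "u \<in> carrier_vec (2 * n)" for u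
  proof (rule eq_vecI)
    fix i assume "i < dim_vec (Mc *\<^sub>v u - (total u / of_nat n) \<cdot>\<^sub>v v)"
    hence i: "i < 2 * n" using v by simp
    have "(A *\<^sub>v u) $ i = (\<Sum>j<2 * n. (Mc $$ (i,j) - v $ i / of_nat n) * u $ j)"
      using i u by (simp add: A_def scalar_prod_def atLeast0LessThan)
    also have "\<dots> = (\<Sum>j<2 * n. Mc $$ (i,j) * u $ j) - v $ i / of_nat n * total u"
      by (simp only: left_diff_distrib sum_subtractf total_def sum_distrib_left)
    also have "\<dots> = (Mc *\<^sub>v u - (total u / of_nat n) \<cdot>\<^sub>v v) $ i"
      using i u v by (simp add: scalar_prod_def atLeast0LessThan)
    finally show "(A *\<^sub>v u) $ i = (Mc *\<^sub>v u - (total u / of_nat n) \<cdot>\<^sub>v v) $ i" .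
  qed (use A v in auto)
  have Av: "A *\<^sub>v v = 0\<^sub>v (2 * n)"
    unfolding A_mult[OF v(1)] v(3) total_v using n v by (intro eq_vecI) auto
  have total_A: "total (A *\<^sub>v u) = 0" if u: "u \<in> carrier_vec (2 * n)" for u
  proof -
    have Mu: "Mc *\<^sub>v u \<in> carrier_vec (2 * n)" by (rule mult_mat_vec_carrier[OF Mc_carrier u])
    have "total (A *\<^sub>v u) = total (Mc *\<^sub>v u) - total ((total u / of_nat n) \<cdot>\<^sub>v v)"
      unfolding A_mult[OF u] using v Mu
      by (simp add: total_def sum_subtractf del: index_mult_mat_vec)
    also have "\<dots> = 0" using n by (simp add: total_Mc[OF u] total_smult[OF v(1)] total_v)
    finally show ?thesis .
  qed
  \<comment> \<open>For \<open>\<mu> \<noteq> 0\<close> an eigenvector of \<open>A\<close> has total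
    0, because the range of \<open>A\<close> does, and so it is one of \<open>Mc\<close>. The value
    1 is ruled out: its eigenvectors are multiples of \<open>v\<close>, and a nonzero multiple has
    nonzero total.\<close>
  have evA: "cmod \<mu> < 1" if ev: "eigenvalue A \<mu>" for \<mu>
  proof (cases "\<mu> = 0")
    case False
    obtain u where u: "u \<in> carrier_vec (2 * n)" "u \<noteq> 0\<^sub>v (2 * n)" and Au: "A *\<^sub>v u = \<mu> \<cdot>\<^sub>v u"
      using ev A by (auto simp: eigenvalue_def eigenvector_def)
    have "\<mu> * total u = 0" using total_A[OF u(1)] total_smult[OF u(1)] Au by simp
    hence t0: "total u = 0" using False by simp
    have "Mc *\<^sub>v u \<in> carrier_vec (2 * n)" by (rule mult_mat_vec_carrier[OF Mc_carrier u(1)])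
    hence "A *\<^sub>v u = Mc *\<^sub>v u"
      unfolding A_mult[OF u(1)] t0 using v by (intro eq_vecI) (auto simp del: index_mult_mat_vec)
    hence Mu: "Mc *\<^sub>v u = \<mu> \<cdot>\<^sub>v u" using Au by simp
    have "\<mu> \<noteq> 1"
    proof
      assume "\<mu> = 1"
      then obtain c where c: "u = c \<cdot>\<^sub>v v"
        using simple_eigenvalue_eigenvectors_proportional[OF Mc_carrier ord v(1,2) _ u(1)] v(3) Mu by auto
      hence "c * of_nat n = 0" using t0 total_smult[OF v(1)] total_v by simp
      hence "c = 0" using n by simp
      hence "u = 0\<^sub>v (2 * n)" using c v by (intro eq_vecI) auto
      thus False using u by simp
    qed
    moreover have "eigenvalue Mc \<mu>" using u Mu unfolding eigenvalue_def eigenvector_def by auto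
    ultimately show ?thesis using small by blast
  qed simp
  show ?thesis
    unfolding average_consensus_def Let_def
  proof (intro ballI allI impI)
    fix x0 :: "real vec" and i assume x0: "x0 \<in> carrier_vec n" and i: "i < 2 * n"
    define xa where "xa = (\<Sum>i<n. x0 $ i) / real n"
    have tot: "total (state x0 k) = of_nat n * of_real xa" for k
    proof (induction k)
      case 0
      show ?case using x0 n by (simp add: total_def sum_lessThan_double state_def xa_def)
    next
      case (Suc k)
      thus ?case by (simp add: state_Suc[OF x0] total_Mc state_carrier[OF x0])
    qed
    \<comment> \<open>The deviation from the consensus limit. Conservation of the total makes the
      rank-one correction in \<open>A\<close> subtract exactly this limit, so \<open>d\<close>
      evolves under \<open>A\<close>.\<close>
    define d where "d k = state x0 k - of_real xa \<cdot>\<^sub>v v" for k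
    have d: "d k \<in> carrier_vec (2 * n)" for k using state_carrier[OF x0] v by (simp add: d_def)
    have d_Suc: "d (Suc k) = A *\<^sub>v d k" for k
    proof -
      have "A *\<^sub>v d k = A *\<^sub>v state x0 k - of_real xa \<cdot>\<^sub>v (A *\<^sub>v v)"
        unfolding d_def using A v state_carrier[OF x0]
        by (simp add: mult_minus_distrib_mat_vec[of A "2 * n" "2 * n"] mult_mat_vec[of A "2 * n" "2 * n"])
      also have "\<dots> = A *\<^sub>v state x0 k"
        unfolding Av using mult_mat_vec_carrier[OF A state_carrier[OF x0, of k]]
        by (intro eq_vecI) (auto simp del: index_mult_mat_vec dim_mult_mat_vec)
      also have "\<dots> = d (Suc k)"
        unfolding A_mult[OF state_carrier[OF x0]] tot d_def state_Suc[OF x0] using n by simp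
      finally show ?thesis by simp
    qed
    \<comment> \<open>The start index \<open>j\<close> is general because \<open>pow_mat\<close>
      multiplies on the right: the factor peeled off acts on \<open>d j\<close> first.\<close>
    have d_pow: "A ^\<^sub>m k *\<^sub>v d j = d (k + j)" for k j
    proof (induction k arbitrary: j)
      case 0
      show ?case using A d[of j] by simp
    next
      case (Suc k)
      have "A ^\<^sub>m Suc k *\<^sub>v d j = A ^\<^sub>m k *\<^sub>v (A *\<^sub>v d j)"
        unfolding pow_mat.simps by (rule assoc_mult_mat_vec[OF pow_carrier_mat[OF A] A d])
      thus ?case using Suc.IH[of "Suc j"] by (simp add: d_Suc)
    qed
    have "d k $ i = (\<Sum>j<2 * n. (A ^\<^sub>m k) $$ (i,j) * d 0 $ j)" for k
    proof -
      define B where "B = A ^\<^sub>m k"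
      have B: "B \<in> carrier_mat (2 * n) (2 * n)" using A by (simp add: B_def)
      have "d k = B *\<^sub>v d 0" using d_pow[of k 0] by (simp add: B_def)
      thus ?thesis unfolding B_def[symmetric] using B d[of 0] i
        by (simp add: scalar_prod_def atLeast0LessThan)
    qed
    moreover have "(\<lambda>k. \<Sum>j<2 * n. (A ^\<^sub>m k) $$ (i,j) * d 0 $ j) \<longlonglongrightarrow> (\<Sum>j<2 * n. 0 * d 0 $ j)"
      by (intro tendsto_sum tendsto_mult tendsto_const pow_mat_tendsto_zero[OF A evA i]) auto
    ultimately have "(\<lambda>k. d k $ i) \<longlonglongrightarrow> 0" by simp
    hence "(\<lambda>k. d k $ i + of_real xa * v $ i) \<longlonglongrightarrow> 0 + of_real xa * v $ i"
      by (intro tendsto_add tendsto_const)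
    moreover have "d k $ i + of_real xa * v $ i = of_real (traj M n x0 k $ i)" for k
      using i v traj_carrier[OF x0, of k] by (simp add: d_def state_def)
    moreover have "0 + of_real xa * v $ i = complex_of_real ((vec n (\<lambda>_. xa) @\<^sub>v 0\<^sub>v n) $ i)"
      using i by (simp add: v_def consensus_vec_def)
    ultimately have "(\<lambda>k. complex_of_real (traj M n x0 k $ i)) \<longlonglongrightarrow>
        complex_of_real ((vec n (\<lambda>_. xa) @\<^sub>v 0\<^sub>v n) $ i)"
      by simp
    thus "(\<lambda>k. traj M n x0 k $ i) \<longlonglongrightarrow> (vec n (\<lambda>_. (\<Sum>i<n. x0 $ i) / real n) @\<^sub>v 0\<^sub>v n) $ i"
      unfolding xa_def by (simp only: tendsto_of_real_iff)
  qed
qed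

end

theorem proposition2:
  fixes n :: nat and E :: "(nat \<times> nat) set" and a b :: "nat \<Rightarrow> nat \<Rightarrow> real" and \<epsilon> :: real
  assumes "n > 1"
    and "E \<subseteq> {0..<n} \<times> {0..<n}"
    and "\<forall>i. (i, i) \<notin> E"
    and "weights_ok n E a b"
    and "\<epsilon> > 0"
  shows "average_consensus n a b \<epsilon> \<longleftrightarrow>
    (let Mc = map_mat complex_of_real (M_mat n a b \<epsilon>) in
       order 1 (char_poly Mc) = 1 \<and>
       (\<forall>z. eigenvalue Mc z \<and> z \<noteq> 1 \<longrightarrow> cmod z < 1))"
proof -
  interpret surplus_algorithm n E a b \<epsilon>
    by unfold_locales (use assms in auto)
  show ?thesis
    unfolding Let_def using consensus_imp_spectrum spectrum_imp_consensus by blast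
qed

end
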